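(* Let $R_b,\sigma>0$ and let $v_s$ be the warp speed. Consider the flat-slice unit-lapse metric $ds^2=-dt^2+\delta_{ij}(dx^i+\beta^i dt)(dx^j+\beta^j dt)$ whose shift, in the orthonormal spherical frame $(r_s,\theta,\phi)$ centred at the bubble centre with polar axis along $+x$, is $$\hat\beta_r=-v_sF(r_s)\cos\theta,\qquad\hat\beta_\theta=v_sG(r_s)\sin\theta,\qquad\hat\beta_\phi=0 .$$ Then the only possibly nonvanishing component of the curl of the shift is the azimuthal one, and $$(\nabla\times\beta)_\phi=\frac{v_s\sin\theta}{r_s}\bigl[(r_sG)'-F\bigr],$$ so the shift is curl-free exactly when $F=(r_sG)'$. The Rodal profiles $$F(r_s)=\frac{\tanh[\sigma(r_s+R_b)]-\tanh[\sigma(r_s-R_b)]}{2\tanh(\sigma R_b)},$$ $$G(r_s)=1-\frac{2r_s\sigma\sinh(R_b\sigma)+\cosh(R_b\sigma)\bigl[\ln\cosh\sigma(r_s-R_b)-\ln\cosh\sigma(r_s+R_b)\bigr]}{2r_s\sigma\sinh(R_b\sigma)}$$ satisfy this relation identically in $(r_s,\sigma,R_b)$. Hence, for the Rodal drive, $\nabla\times\beta\equiv0$, so the Eulerian momentum density $j\equiv0$, so $T^a{}_b$ is block diagonal $(-\rho_n)\oplus S_{ij}$ with $S$ symmetric: its spectrum is real and the slice normal $n^a$ is a timelike eigenvector. The drive is Hawking--Ellis Type I at every point of every slice $t=\text{const}$, at every $v_s$. The same (Type I at every point of every slice, with $\nabla\times\beta\equiv0$, $j\equiv0$ and block-diagonal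 $T^a{}_b$) holds for the Garattini--Zatrimaylov bubble on its matching condition.
   Context: Signature $(-+++)$, units $G=c=1$; $T_{ab}=G_{ab}/8\pi$ with $G_{ab}$ the Einstein tensor of the metric. $n^a=\partial_t-\beta^i\partial_i$ is the unit normal to the slices, $h^a{}_b=\delta^a{}_b+n^an_b$, $\rho_n=T_{ab}n^an^b$, $j^i=-h^i{}_aT^a{}_bn^b$, $S_{ij}=h_i{}^ah_j{}^bT_{ab}$. A point is Hawking--Ellis Type I if $T^a{}_b$ has four real eigenvalues with a timelike eigenvector (signature of the eigenframe: eigenvalues $-\rho,p_1,p_2,p_3$). Rodal drive: the bubble centre is at $x_s(t)=v_st$ on the $x$-axis, $r_s=\sqrt{(x-x_s)^2+y^2+z^2}$, $\theta$ is the polar angle measured from $+x$, and primes denote $d/dr_s$. The apparent singularity at $r_s=0$ is removable: $F(0)=G(0)=1$, and in Cartesian form $\boldsymbol\beta=-v_s[G\,\hat{\boldsymbol x}+(F-G)n_x\boldsymbol n]$ with $\boldsymbol n$ the radial unit vector from the bubble centre and $n_x=(x-x_s)/r_s$. Garattini--Zatrimaylov bubble: lapse $1$, spatial metric $\delta_{ij}$, shift $\beta^i=-(1-f(r_s))\,x^i/L-f(r_s)\,v^i$ with $L=H^{-1}$, $H>0$, where $f$ has the same formula as $F$ above, and $r_s$ is the Euclidean distance from the bubble centre $\mathbf{x}_s(t)$. Matching condition: the bubble co-moves radially with the Hubble flow, $|\mathbf{x}_s(t)|=r(t)=r_0e^{Ht}$, with velocity $v^i=Hx_s^i(t)$ (speed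 $v=Hr(t)$), so that $\beta=-\mathbf{x}/L+f(r_s)(\mathbf{x}-\mathbf{x}_s)/L$. *)

theory Defs
  imports "HOL-Analysis.Analysis"
begin

section \<open>Vector calculus in Cartesian coordinates\<close>

definition partial :: "'n \<Rightarrow> (real^'n \<Rightarrow> real) \<Rightarrow> real^'n \<Rightarrow> real"
  where "partial i f x = deriv (\<lambda>h. f (x + h *\<^sub>R axis i 1)) 0"

definition curl :: "(real^3 \<Rightarrow> real^3) \<Rightarrow> real^3 \<Rightarrow> real^3"
  where "curl u x = vector
    [partial 2 (\<lambda>y. u y $ 3) x - partial 3 (\<lambda>y. u y $ 2) x,
     partial 3 (\<lambda>y. u y $ 1) x - partial 1 (\<lambda>y. u y $ 3) x,
     partial 1 (\<lambda>y. u y $ 2) x - partial 2 (\<lambda>y. u y $ 1) x]"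

text \<open>Differentiability is demanded so that a vanishing curl cannot come from the default
  value of \<^const>\<open>deriv\<close> at a point where a partial derivative does not exist.\<close>

definition curl_free_at :: "(real^3 \<Rightarrow> real^3) \<Rightarrow> real^3 \<Rightarrow> bool"
  where "curl_free_at u x \<longleftrightarrow> u differentiable (at x) \<and> curl u x = 0"

text \<open>The orthonormal spherical frame with polar axis along \<open>+x\<close>; the azimuth runs from
  \<open>+y\<close> to \<open>+z\<close>, so that the frame is right-handed.\<close>

definition e_r :: "real \<Rightarrow> real \<Rightarrow> real^3"
  where "e_r \<theta> \<phi> = vector [cos \<theta>, sin \<theta> * cos \<phi>, sin \<theta> * sin \<phi>]"

definition e_theta :: "real \<Rightarrow> real \<Rightarrow> real^3"
  where "e_theta \<theta> \<phi> = vector [- sin \<theta>, cos \<theta> * cos \<phi>, cos \<theta> * sin \<phi>]"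

definition e_phi :: "real \<Rightarrow> real \<Rightarrow> real^3"
  where "e_phi \<theta> \<phi> = vector [0, - sin \<phi>, cos \<phi>]"


section \<open>Curvature of a Lorentzian metric on \<open>\<real>\<^sup>4\<close>\<close>

text \<open>The index type \<open>4\<close> is arithmetic modulo 4, so its elements are 0, 1, 2, 3: index 0 is
  time and indices 1, 2, 3 are space.\<close>

definition event :: "real \<Rightarrow> real^3 \<Rightarrow> real^4"
  where "event t x =
    (\<chi> a. if a = 1 then x $ 1 else if a = 2 then x $ 2 else if a = 3 then x $ 3 else t)"

definition time_part :: "real^4 \<Rightarrow> real"
  where "time_part p = p $ 0"

definition space_part :: "real^4 \<Rightarrow> real^3"
  where "space_part p = vector [p $ 1, p $ 2, p $ 3]"

definition ginner :: "real^4^4 \<Rightarrow> real^4 \<Rightarrow> real^4 \<Rightarrow> real"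
  where "ginner g u w = u \<bullet> (g *v w)"

type_synonym metric_field = "real^4 \<Rightarrow> real^4^4"

text \<open>\<open>christoffel g a b c\<close> is \<open>\<Gamma>\<^sup>a\<^sub>b\<^sub>c\<close> and \<open>riemann g a b c d\<close> is \<open>R\<^sup>a\<^sub>b\<^sub>c\<^sub>d\<close>, with the sign
  convention in which de Sitter space has positive scalar curvature.\<close>

definition christoffel :: "metric_field \<Rightarrow> 4 \<Rightarrow> 4 \<Rightarrow> 4 \<Rightarrow> real^4 \<Rightarrow> real"
  where "christoffel g a b c p =
    (\<Sum>d\<in>UNIV. matrix_inv (g p) $ a $ d *
       (partial b (\<lambda>q. g q $ d $ c) p + partial c (\<lambda>q. g q $ d $ b) p
        - partial d (\<lambda>q. g q $ b $ c) p)) / 2"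

definition riemann :: "metric_field \<Rightarrow> 4 \<Rightarrow> 4 \<Rightarrow> 4 \<Rightarrow> 4 \<Rightarrow> real^4 \<Rightarrow> real"
  where "riemann g a b c d p =
    partial c (christoffel g a d b) p - partial d (christoffel g a c b) p
    + (\<Sum>e\<in>UNIV. christoffel g a c e p * christoffel g e d b p
               - christoffel g a d e p * christoffel g e c b p)"

definition ricci :: "metric_field \<Rightarrow> metric_field"
  where "ricci g p = (\<chi> b d. \<Sum>a\<in>UNIV. riemann g a b a d p)"

definition scalar_curvature :: "metric_field \<Rightarrow> real^4 \<Rightarrow> real"
  where "scalar_curvature g p = (\<Sum>b\<in>UNIV. \<Sum>d\<in>UNIV. matrix_inv (g p) $ b $ d * ricci g p $ b $ d)"

definition einstein :: "metric_field \<Rightarrow> metric_field"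
  where "einstein g p = ricci g p - (scalar_curvature g p / 2) *\<^sub>R g p"

definition stress_energy :: "metric_field \<Rightarrow> metric_field"
  where "stress_energy g p = (1 / (8 * pi)) *\<^sub>R einstein g p"

definition mixed_stress_energy :: "metric_field \<Rightarrow> metric_field"
  where "mixed_stress_energy g p = matrix_inv (g p) ** stress_energy g p"

text \<open>Hawking--Ellis Type I for a metric \<open>g\<close> and a mixed tensor \<open>A = T\<^sup>a\<^sub>b\<close> at a point: four real
  eigenvalues \<open>-\<rho>, p\<^sub>1, p\<^sub>2, p\<^sub>3\<close> (counted with multiplicity), realised by an orthonormal
  eigenframe whose timelike leg has eigenvalue \<open>-\<rho>\<close>.\<close>

definition hawking_ellis_type_I :: "real^4^4 \<Rightarrow> real^4^4 \<Rightarrow> bool"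
  where "hawking_ellis_type_I g A \<longleftrightarrow>
    (\<exists>\<rho> (p :: 4 \<Rightarrow> real) (E :: 4 \<Rightarrow> real^4).
       (\<forall>x. det (mat x - A) = (x + \<rho>) * (x - p 1) * (x - p 2) * (x - p 3)) \<and>
       (\<forall>a b. ginner g (E a) (E b) = (if a \<noteq> b then 0 else if a = 0 then - 1 else 1)) \<and>
       A *v E 0 = (- \<rho>) *\<^sub>R E 0 \<and>
       (\<forall>i. i \<noteq> 0 \<longrightarrow> A *v E i = p i *\<^sub>R E i))"

definition real_spectrum :: "real^'n^'n \<Rightarrow> bool"
  where "real_spectrum A \<longleftrightarrow>
    (\<forall>(l :: complex) (w :: complex^'n).
       w \<noteq> 0 \<and> (\<chi> a b. complex_of_real (A $ a $ b)) *v w = l *s w \<longrightarrow> l \<in> \<real>)"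


section \<open>Flat-slice unit-lapse metrics\<close>

type_synonym shift_field = "real \<Rightarrow> real^3 \<Rightarrow> real^3"

text \<open>The polarised line element \<open>-dt\<^sup>2 + \<delta>\<^sub>i\<^sub>j (dx\<^sup>i + \<beta>\<^sup>i dt) (dx\<^sup>j + \<beta>\<^sup>j dt)\<close>.\<close>

definition shift_line_element :: "shift_field \<Rightarrow> real^4 \<Rightarrow> real^4 \<Rightarrow> real^4 \<Rightarrow> real"
  where "shift_line_element \<beta> p u w =
    (let b = \<beta> (time_part p) (space_part p) in
       - (time_part u * time_part w)
       + (space_part u + time_part u *\<^sub>R b) \<bullet> (space_part w + time_part w *\<^sub>R b))"

definition shift_metric :: "shift_field \<Rightarrow> metric_field"
  where "shift_metric \<beta> p = (\<chi> a c. shift_line_element \<beta> p (axis a 1) (axis c 1))"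

definition slice_normal :: "shift_field \<Rightarrow> real^4 \<Rightarrow> real^4"
  where "slice_normal \<beta> p = event 1 (- \<beta> (time_part p) (space_part p))"

definition slice_projector :: "shift_field \<Rightarrow> metric_field"
  where "slice_projector \<beta> p =
    mat 1 + (\<chi> a c. slice_normal \<beta> p $ a * (shift_metric \<beta> p *v slice_normal \<beta> p) $ c)"

definition energy_density :: "shift_field \<Rightarrow> real^4 \<Rightarrow> real"
  where "energy_density \<beta> p =
    slice_normal \<beta> p \<bullet> (stress_energy (shift_metric \<beta>) p *v slice_normal \<beta> p)"

text \<open>The time component of this spacetime vector vanishes identically, because the projector
  annihilates \<open>dt\<close>.\<close>

definition momentum_density :: "shift_field \<Rightarrow> real^4 \<Rightarrow> real^4"
  where "momentum_density \<beta> p =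
    - (slice_projector \<beta> p *v (mixed_stress_energy (shift_metric \<beta>) p *v slice_normal \<beta> p))"

text \<open>The components \<open>S\<^sub>i\<^sub>j\<close> are the entries with both indices nonzero.\<close>

definition spatial_stress :: "shift_field \<Rightarrow> metric_field"
  where "spatial_stress \<beta> p =
    transpose (slice_projector \<beta> p) ** stress_energy (shift_metric \<beta>) p ** slice_projector \<beta> p"

text \<open>The columns are the orthonormal Eulerian frame \<open>n, \<partial>\<^sub>1, \<partial>\<^sub>2, \<partial>\<^sub>3\<close>.\<close>

definition eulerian_frame :: "shift_field \<Rightarrow> metric_field"
  where "eulerian_frame \<beta> p =
    (\<chi> a c. if c = 0 then slice_normal \<beta> p $ a else axis c 1 $ a)"

text \<open>\<open>T\<^sup>a\<^sub>b = (-\<rho>\<^sub>n) \<oplus> S\<^sub>i\<^sub>j\<close> in the Eulerian frame, with \<open>S\<close> symmetric.\<close>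

definition eulerian_block_diagonal :: "shift_field \<Rightarrow> real^4 \<Rightarrow> bool"
  where "eulerian_block_diagonal \<beta> p \<longleftrightarrow>
    matrix_inv (eulerian_frame \<beta> p) ** mixed_stress_energy (shift_metric \<beta>) p
        ** eulerian_frame \<beta> p
      = (\<chi> a c. if a = 0 \<and> c = 0 then - energy_density \<beta> p
               else if a = 0 \<or> c = 0 then 0
               else spatial_stress \<beta> p $ a $ c)
    \<and> (\<forall>i j. i \<noteq> 0 \<and> j \<noteq> 0 \<longrightarrow> spatial_stress \<beta> p $ i $ j = spatial_stress \<beta> p $ j $ i)"

definition timelike_eigenvector :: "real^4^4 \<Rightarrow> real^4^4 \<Rightarrow> real^4 \<Rightarrow> bool"
  where "timelike_eigenvector g A u \<longleftrightarrow> ginner g u u < 0 \<and> (\<exists>l::real. A *v u = l *\<^sub>R u)"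


section \<open>The two drives\<close>

definition bubble_centre :: "real \<Rightarrow> real \<Rightarrow> real^3"
  where "bubble_centre v t = vector [v * t, 0, 0]"

definition has_warp_components ::
    "real \<Rightarrow> (real \<Rightarrow> real) \<Rightarrow> (real \<Rightarrow> real) \<Rightarrow> shift_field \<Rightarrow> bool"
  where "has_warp_components v F G \<beta> \<longleftrightarrow>
    (\<forall>t r \<theta> \<phi>. r > 0 \<and> 0 \<le> \<theta> \<and> \<theta> \<le> pi \<longrightarrow>
       (let b = \<beta> t (bubble_centre v t + r *\<^sub>R e_r \<theta> \<phi>) in
          b \<bullet> e_r \<theta> \<phi> = - v * F r * cos \<theta> \<and>
          b \<bullet> e_theta \<theta> \<phi> = v * G r * sin \<theta> \<and>
          b \<bullet> e_phi \<theta> \<phi> = 0))"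

definition rodal_F :: "real \<Rightarrow> real \<Rightarrow> real \<Rightarrow> real"
  where "rodal_F \<sigma> R r =
    (tanh (\<sigma> * (r + R)) - tanh (\<sigma> * (r - R))) / (2 * tanh (\<sigma> * R))"

definition rodal_G :: "real \<Rightarrow> real \<Rightarrow> real \<Rightarrow> real"
  where "rodal_G \<sigma> R r =
    (if r = 0 then 1
     else 1 - (2 * r * \<sigma> * sinh (R * \<sigma>)
               + cosh (R * \<sigma>) * (ln (cosh (\<sigma> * (r - R))) - ln (cosh (\<sigma> * (r + R)))))
              / (2 * r * \<sigma> * sinh (R * \<sigma>)))"

text \<open>The Cartesian form of the shift, which includes the bubble centre: there division by zero
  gives the radial unit vector the value \<open>0\<close>, and the shift is \<open>- v G(0)\<close> times the unit
  vector along \<open>+x\<close>.\<close>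

definition rodal_shift :: "real \<Rightarrow> real \<Rightarrow> real \<Rightarrow> shift_field"
  where "rodal_shift \<sigma> R v t x =
    (let r = norm (x - bubble_centre v t);
         m = (x - bubble_centre v t) /\<^sub>R r
     in - v *\<^sub>R (rodal_G \<sigma> R r *\<^sub>R axis 1 1
                + ((rodal_F \<sigma> R r - rodal_G \<sigma> R r) * m $ 1) *\<^sub>R m))"

definition gz_shift ::
    "real \<Rightarrow> real \<Rightarrow> real \<Rightarrow> (real \<Rightarrow> real^3) \<Rightarrow> (real \<Rightarrow> real^3) \<Rightarrow> shift_field"
  where "gz_shift \<sigma> R H xs v t x =
    (let L = 1 / H; f = rodal_F \<sigma> R (norm (x - xs t))
     in - ((1 - f) *\<^sub>R (x /\<^sub>R L)) - f *\<^sub>R v t)"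

definition gz_matching ::
    "real \<Rightarrow> real \<Rightarrow> (real \<Rightarrow> real^3) \<Rightarrow> (real \<Rightarrow> real^3) \<Rightarrow> bool"
  where "gz_matching H r0 xs v \<longleftrightarrow>
    (\<forall>t. norm (xs t) = r0 * exp (H * t) \<and>
         (xs has_vector_derivative v t) (at t) \<and>
         v t = H *\<^sub>R xs t)"

end

theory Submission
  imports Defs
begin

text \<open>
  For a curl-free shift the Christoffel symbols of the flat-slice unit-lapse metric collapse to
  \<open>\<Gamma>\<^sup>a\<^sub>b\<^sub>c = A\<^sup>a \<delta>\<^sup>0\<^sub>b \<delta>\<^sup>0\<^sub>c - n\<^sup>a \<sigma>\<^sub>b\<^sub>c\<close>, where \<open>\<sigma>\<close> is the symmetric extension of \<open>\<partial>\<^sub>i \<beta>\<^sub>j\<close> with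
  \<open>\<sigma>\<^sub>b\<^sub>c n\<^sup>c = 0\<close> and \<open>A\<^sup>i = n\<^sup>a \<partial>\<^sub>a \<beta>\<^sup>i\<close>. Hence \<open>\<Gamma>\<^sup>a\<^sub>a\<^sub>b = 0\<close>, the Ricci tensor is
  \<open>\<partial>\<^sub>a \<Gamma>\<^sup>a\<^sub>b\<^sub>c - \<Gamma>\<^sup>a\<^sub>c\<^sub>e \<Gamma>\<^sup>e\<^sub>a\<^sub>b\<close>, visibly symmetric, and its mixed components \<open>R\<^sub>i\<^sub>b n\<^sup>b\<close> cancel by the
  product rule alone. The slice normal is then an eigenvector of the stress-energy tensor, and
  diagonalising the symmetric spatial block completes it to an orthonormal eigenframe.

  Smoothness at the bubble centre is obtained from the profiles being smooth even functions:
  \<open>F r = cosh\<^sup>2 (\<sigma> R) / (cosh\<^sup>2 (\<sigma> r) + sinh\<^sup>2 (\<sigma> R))\<close>, and \<open>G r\<close> is the integral of \<open>F (s r)\<close> over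
  \<open>s\<close> in \<open>[0, 1]\<close> because \<open>(r G)' = F\<close>.
\<close>

section \<open>Self-adjoint maps and orthonormal eigenframes\<close>

text \<open>In the index type the numeral 4 equals 0, so the rules running over 1, 2, 3, 4 are
  restated with the time index 0 first.\<close>

lemma all_index4: "(\<forall>i::4. P i) \<longleftrightarrow> P 0 \<and> P 1 \<and> P 2 \<and> P 3"
  and sum_index4: "sum f (UNIV :: 4 set) = f 0 + f 1 + f 2 + f 3"
  and prod_index4: "prod h (UNIV :: 4 set) = h 0 * h 1 * h 2 * (h 3 :: 'b::comm_monoid_mult)"
proof -
  have four: "(4::4) = 0" by simp
  show "(\<forall>i::4. P i) \<longleftrightarrow> P 0 \<and> P 1 \<and> P 2 \<and> P 3" using forall_4[of P] unfolding four by blast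
  show "sum f (UNIV :: 4 set) = f 0 + f 1 + f 2 + f 3"
    using sum_4[of f] unfolding four by (simp add: ac_simps)
  show "prod h (UNIV :: 4 set) = h 0 * h 1 * h 2 * h 3"
    unfolding UNIV_4 four by (simp add: ac_simps)
qed

lemma index4_induct: "P 0 \<Longrightarrow> P 1 \<Longrightarrow> P 2 \<Longrightarrow> P 3 \<Longrightarrow> P (a::4)"
  using all_index4[of P] by blast

text \<open>The quadratic form of \<open>f\<close> attains its maximum on the unit sphere of the
  orthogonal complement of \<open>B\<close>. That complement is nonzero by dimension and invariant
  by self-adjointness, and a maximiser is an eigenvector.\<close>

lemma self_adjoint_eigenvector:
  fixes f :: "'a::euclidean_space \<Rightarrow> 'a"
  assumes lin: "linear f" and sym: "\<And>x y. x \<bullet> f y = f x \<bullet> y"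
    and fin: "finite B" and card: "card B < DIM('a)"
    and eig: "\<And>b. b \<in> B \<Longrightarrow> \<exists>l. f b = l *\<^sub>R b"
  obtains u l where "norm u = 1" "f u = l *\<^sub>R u" "\<And>b. b \<in> B \<Longrightarrow> u \<bullet> b = 0"
proof -
  define S where "S = {x. \<forall>b\<in>B. x \<bullet> b = 0}"
  interpret f: linear f by (rule lin)
  have dimB: "dim B < DIM('a)"
    using dim_le_card'[OF fin] card by linarith
  obtain z where z: "z \<noteq> 0" "\<And>y. y \<in> span B \<Longrightarrow> orthogonal z y"
    using orthogonal_to_subspace_exists[OF dimB] by blast
  have "z /\<^sub>R norm z \<in> S \<inter> sphere 0 1"
    using z span_base[of _ B] by (auto simp: S_def orthogonal_def)
  then have ne: "S \<inter> sphere 0 1 \<noteq> {}" by blast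
  have "S = (\<Inter>b\<in>B. {x. x \<bullet> b = 0})" by (auto simp: S_def)
  then have "closed S" by (auto intro!: closed_Collect_eq continuous_intros)
  then have comp: "compact (S \<inter> sphere 0 1)"
    by (simp add: closed_Int_compact)
  have contf: "continuous_on A f" for A
    by (simp add: lin linear_continuous_on linear_conv_bounded_linear[symmetric])
  obtain u where u: "u \<in> S" "norm u = 1"
    and umax: "\<And>y. y \<in> S \<Longrightarrow> norm y = 1 \<Longrightarrow> y \<bullet> f y \<le> u \<bullet> f u"
    using continuous_attains_sup[OF comp ne continuous_on_inner[OF continuous_on_id contf]]
    by auto
  define l where "l = u \<bullet> f u"
  have umax': "y \<bullet> f y \<le> l * (y \<bullet> y)" if "y \<in> S" for y
  proof (cases "y = 0")
    case False
    have "y /\<^sub>R norm y \<in> S" using that by (auto simp: S_def)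
    then have "(y /\<^sub>R norm y) \<bullet> f (y /\<^sub>R norm y) \<le> l"
      using umax[of "y /\<^sub>R norm y"] False by (simp add: l_def)
    then have "(y \<bullet> f y) / (norm y)\<^sup>2 \<le> l"
      by (simp add: f.scaleR power2_eq_square divide_inverse algebra_simps)
    then show ?thesis using False
      by (simp add: divide_le_eq power2_norm_eq_inner)
  qed (simp add: f.zero)
  \<comment> \<open>The residual \<open>w\<close> is orthogonal to \<open>u\<close> and lies in
    \<open>S\<close>, so \<open>u\<close> moved along \<open>w\<close> is an admissible competitor;
    the aim is \<open>w = 0\<close>.\<close>
  define w where "w = f u - l *\<^sub>R u"
  have uu: "u \<bullet> u = 1" using u(2) by (simp add: dot_square_norm)
  have "f u \<in> S" unfolding S_def
  proof safe
    fix b assume "b \<in> B"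
    then obtain m where "f b = m *\<^sub>R b" using eig by blast
    then show "f u \<bullet> b = 0" using u(1) \<open>b \<in> B\<close> by (simp add: sym[symmetric] S_def)
  qed
  then have wS: "w \<in> S" using u(1) by (auto simp: w_def S_def inner_diff_left)
  have uw: "u \<bullet> w = 0" "w \<bullet> u = 0"
    by (simp_all add: w_def inner_diff_right inner_diff_left uu l_def inner_commute)
  have wfu: "w \<bullet> f u = w \<bullet> w"
    using uw by (simp add: w_def inner_diff_right inner_diff_left)
  define c where "c = l * (w \<bullet> w) - w \<bullet> f w"
  \<comment> \<open>Against this competitor the gain of first order in \<open>e\<close> is
    \<open>2 * e * (w \<bullet> w)\<close>, and \<open>c\<close> collects everything of second
    order; dividing by \<open>e\<close> leaves this bound.\<close>
  have key: "2 * (w \<bullet> w) \<le> e * c" if "e > 0" for e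
  proof -
    have "u + e *\<^sub>R w \<in> S" using u(1) wS by (auto simp: S_def inner_add_left)
    from umax'[OF this] have "e * (2 * (w \<bullet> w)) \<le> e * (e * c)"
      by (simp add: f.add f.scaleR inner_add_left inner_add_right uw wfu uu sym[of u w]
          inner_commute[of "f u" w] c_def l_def algebra_simps)
    then show ?thesis using that by simp
  qed
  have "w \<bullet> w \<le> 0"
  proof (rule ccontr)
    assume "\<not> ?thesis"
    then have pos: "w \<bullet> w > 0" by (rule not_le_imp_less)
    \<comment> \<open>The choice \<open>e = (w \<bullet> w) / (\<bar>c\<bar> + 1)\<close> keeps the
      right-hand side of \<open>key\<close> at or below \<open>w \<bullet> w\<close>.\<close>
    have "2 * (w \<bullet> w) \<le> (w \<bullet> w) / (\<bar>c\<bar> + 1) * c"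
      by (rule key) (rule divide_pos_pos[OF pos], linarith)
    also have "\<dots> \<le> (w \<bullet> w) / (\<bar>c\<bar> + 1) * (\<bar>c\<bar> + 1)"
      using pos by (intro mult_left_mono) auto
    also have "\<dots> = w \<bullet> w" by simp
    finally show False using pos by simp
  qed
  then have "w = 0" by (metis inner_eq_zero_iff inner_ge_zero order_antisym)
  then have "f u = l *\<^sub>R u" by (simp add: w_def)
  with u that show ?thesis by (auto simp: S_def)
qed

section \<open>Eigenframes and Type I\<close>

lemma matrix_diff_left: "(A - B) ** C = A ** C - B ** (C :: real^'n^'m)"
  and matrix_diff_right: "C ** (D - E) = C ** D - (C :: real^'n^'m) ** E"
  by (simp_all add: vec_eq_iff matrix_matrix_mult_def algebra_simps sum_subtractf)

text \<open>Conjugation by the matrix \<open>P\<close> of eigenvectors diagonalises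
  \<open>A\<close>, which gives the characteristic polynomial. The rows of the inverse of
  \<open>P\<close> are left eigenvectors and detect the eigenvalue of any complex
  eigenvector.\<close>

lemma eigenbasis_det_real_spectrum:
  fixes A :: "real^'n^'n" and E :: "'n \<Rightarrow> real^'n"
  assumes eig: "\<And>a. A *v E a = d a *\<^sub>R E a"
    and inv: "invertible (\<chi> i a. E a $ i)"
  shows "det (mat x - A) = (\<Prod>a\<in>UNIV. x - d a)" and "real_spectrum A"
proof -
  define P where "P = (\<chi> i a. E a $ i)"
  define D :: "real^'n^'n" where "D = (\<chi> i j. if i = j then d i else 0)"
  have eig': "(\<Sum>k\<in>UNIV. A $ i $ k * E a $ k) = d a * E a $ i" for i a
    using arg_cong[OF eig[of a], of "\<lambda>v. v $ i"] by (simp add: matrix_vector_mult_def)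
  have AP: "A ** P = P ** D"
    by (simp add: vec_eq_iff matrix_matrix_mult_def P_def D_def eig' if_distrib cong: if_cong)
  have "(mat x - A) ** P = P ** (mat x - D)"
  proof -
    have "mat x ** P = P ** mat x"
      by (simp add: vec_eq_iff matrix_matrix_mult_def mat_def if_distrib if_distribR mult.commute
          cong: if_cong)
    then show ?thesis
      by (simp add: matrix_diff_left matrix_diff_right AP)
  qed
  then have "det (mat x - A) * det P = det P * det (mat x - D)"
    by (metis det_mul)
  moreover have "det P \<noteq> 0" using inv by (simp add: P_def invertible_det_nz)
  moreover have "det (mat x - D) = (\<Prod>a\<in>UNIV. x - d a)"
    by (subst det_diagonal) (auto simp: D_def mat_def)
  ultimately show "det (mat x - A) = (\<Prod>a\<in>UNIV. x - d a)" by simp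
  obtain Q where QP: "Q ** P = mat 1" and PQ: "P ** Q = mat 1"
    using inv unfolding P_def invertible_def by blast
  have QA: "Q ** A = D ** Q"
  proof -
    have "Q ** A = Q ** A ** (P ** Q)" by (simp add: PQ)
    also have "\<dots> = Q ** (A ** P) ** Q" by (simp add: matrix_mul_assoc)
    also have "\<dots> = D ** Q" by (simp add: AP matrix_mul_assoc QP)
    finally show ?thesis .
  qed
  have QA': "(\<Sum>i\<in>UNIV. Q $ a $ i * A $ i $ k) = d a * Q $ a $ k" for a k
    using arg_cong[OF QA, of "\<lambda>X. X $ a $ k"]
    by (simp add: matrix_matrix_mult_def D_def if_distrib if_distribR cong: if_cong)
  have PQ': "(\<Sum>a\<in>UNIV. P $ i $ a * Q $ a $ k) = (if i = k then 1 else 0)" for i k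
    using arg_cong[OF PQ, of "\<lambda>X. X $ i $ k"] by (simp add: matrix_matrix_mult_def mat_def)
  show "real_spectrum A" unfolding real_spectrum_def
  proof (intro allI impI)
    fix l :: complex and w :: "complex^'n"
    assume lw: "w \<noteq> 0 \<and> (\<chi> a b. complex_of_real (A $ a $ b)) *v w = l *s w"
    have Aw: "(\<Sum>k\<in>UNIV. of_real (A $ i $ k) * w $ k) = l * w $ i" for i
      using arg_cong[OF conjunct2[OF lw], of "\<lambda>v. v $ i"] by (simp add: matrix_vector_mult_def)
    \<comment> \<open>The \<open>q a\<close> are the coordinates of \<open>w\<close> in the
      eigenbasis: \<open>l\<close> and the real \<open>d a\<close> act on each of them alike, and
      not all of them are zero.\<close>
    define q where "q a = (\<Sum>i\<in>UNIV. of_real (Q $ a $ i) * w $ i)" for a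
    have lq: "l * q a = of_real (d a) * q a" for a
    proof -
      have "l * q a = (\<Sum>i\<in>UNIV. of_real (Q $ a $ i) * (\<Sum>k\<in>UNIV. of_real (A $ i $ k) * w $ k))"
        by (simp add: Aw q_def sum_distrib_left mult.left_commute)
      also have "\<dots> = (\<Sum>k\<in>UNIV. of_real (\<Sum>i\<in>UNIV. Q $ a $ i * A $ i $ k) * w $ k)"
        by (simp add: sum_distrib_left sum_distrib_right mult.assoc) (rule sum.swap)
      also have "\<dots> = of_real (d a) * q a"
        by (simp only: QA') (simp add: q_def sum_distrib_left mult.assoc)
      finally show ?thesis .
    qed
    obtain k where k: "w $ k \<noteq> 0" using lw by (auto simp: vec_eq_iff)
    have "(\<Sum>a\<in>UNIV. of_real (P $ k $ a) * q a) =
        (\<Sum>i\<in>UNIV. of_real (\<Sum>a\<in>UNIV. P $ k $ a * Q $ a $ i) * w $ i)"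
      by (simp add: q_def sum_distrib_left sum_distrib_right mult.assoc) (rule sum.swap)
    also have "\<dots> = w $ k" by (simp only: PQ') (simp add: if_distrib if_distribR cong: if_cong)
    finally have "\<exists>a. q a \<noteq> 0" using k by (metis (no_types, lifting) mult_zero_right sum.neutral)
    then obtain a where "q a \<noteq> 0" ..
    with lq[of a] have "l = of_real (d a)" by simp
    then show "l \<in> \<real>" by simp
  qed
qed

definition minkowski :: "real^4^4"
  where "minkowski = (\<chi> a c. if a \<noteq> c then 0 else if a = 0 then - 1 else 1)"

lemma minkowski_square: "minkowski ** minkowski = mat 1"
  by (simp add: vec_eq_iff all_index4 matrix_matrix_mult_def sum_index4 minkowski_def mat_def)

lemma minkowski_mult_vec: "minkowski *v x = (\<chi> a. if a = 0 then - x $ 0 else x $ a)"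
  by (simp add: vec_eq_iff all_index4 matrix_vector_mult_def sum_index4 minkowski_def)

lemma ginner_transpose: "ginner g (M *v u) (M *v w) = u \<bullet> ((transpose M ** g ** M) *v w)"
  by (simp only: ginner_def matrix_vector_mul_assoc[symmetric] dot_lmul_matrix[symmetric]
      vector_transpose_matrix)

text \<open>\<open>M\<close> holds an orthonormal frame and \<open>minkowski ** K\<close> is
  \<open>T\<close> in that frame. Take a Euclidean orthonormal eigenbasis of the symmetric
  \<open>K\<close> containing the time axis: its other members are spatial, so
  \<open>minkowski\<close> fixes them. It is therefore an eigenbasis of
  \<open>minkowski ** K\<close> too, orthonormal in the Lorentzian sense.\<close>

lemma type_I_of_block_diagonal:
  assumes frame: "transpose M ** g ** M = minkowski"
    and TM: "T ** M = M ** (minkowski ** K)"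
    and Ksym: "transpose K = K" and K0: "\<And>i. i \<noteq> 0 \<Longrightarrow> K $ i $ 0 = 0"
  shows "hawking_ellis_type_I g T" and "real_spectrum T"
proof -
  let ?f = "\<lambda>x. K *v x"
  have lin: "linear ?f" by (rule matrix_vector_mul_linear)
  have sym: "x \<bullet> ?f y = ?f x \<bullet> y" for x y
    by (metis Ksym dot_lmul_matrix transpose_matrix_vector)
  have e0: "?f (axis 0 1) = K $ 0 $ 0 *\<^sub>R axis 0 1"
    using K0 by (simp add: vec_eq_iff matrix_vector_mult_basis column_def) (simp add: axis_def)
  have ex: "\<exists>u l. norm u = 1 \<and> ?f u = l *\<^sub>R u \<and> (\<forall>b\<in>B. u \<bullet> b = 0)"
    if "finite B" "card B < 4" "\<forall>b\<in>B. \<exists>l. ?f b = l *\<^sub>R b" for B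
    using self_adjoint_eigenvector[OF lin sym that(1)] that(2,3)
    by (metis DIM_cart DIM_real card_bit0 card_num1 mult.right_neutral mult_2 one_add_one numeral_Bit0)
  have card2: "card {x, y} < 4" and card3: "card {x, y, z} < 4" for x y z :: "real^4"
    using card_length[of "[x, y]"] card_length[of "[x, y, z]"] by simp_all
  obtain u1 l1 where u1: "norm u1 = 1" "?f u1 = l1 *\<^sub>R u1" "u1 \<bullet> axis 0 1 = 0"
    using ex[of "{axis 0 1}"] e0 by auto
  obtain u2 l2 where u2: "norm u2 = 1" "?f u2 = l2 *\<^sub>R u2" "u2 \<bullet> axis 0 1 = 0" "u2 \<bullet> u1 = 0"
    using ex[of "{axis 0 1, u1}"] e0 u1(2) card2 by auto
  obtain u3 l3 where u3: "norm u3 = 1" "?f u3 = l3 *\<^sub>R u3" "u3 \<bullet> axis 0 1 = 0" "u3 \<bullet> u1 = 0"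
    "u3 \<bullet> u2 = 0"
    using ex[of "{axis 0 1, u1, u2}"] e0 u1(2) u2(2) card3 by auto
  define u where "u a = (if a = 1 then u1 else if a = 2 then u2 else if a = 3 then u3 else axis 0 1)"
    for a :: 4
  \<comment> \<open>The sign at index 0 comes from \<open>minkowski\<close>, which reverses the time
    axis; hence \<open>\<rho>\<close> is \<open>K $ 0 $ 0\<close>.\<close>
  define p where "p a = (if a = 1 then l1 else if a = 2 then l2 else if a = 3 then l3 else - K $ 0 $ 0)"
    for a :: 4
  define E where "E a = M *v u a" for a
  have uorth: "\<forall>a b. u a \<bullet> u b = (if a = b then 1 else 0)"
    using u1 u2 u3 by (simp add: u_def all_index4 inner_commute dot_square_norm inner_axis_axis)
  have u0: "\<forall>a. u a $ 0 = (if a = 0 then 1 else 0)"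
    using u1(3) u2(3) u3(3) by (simp add: u_def all_index4 inner_axis)
  have mu: "minkowski *v u a = (if a = 0 then - u a else u a)" for a
  proof (cases "a = 0")
    case True
    then show ?thesis by (simp add: minkowski_mult_vec vec_eq_iff u_def axis_def)
  next
    case False
    then have "u a $ 0 = 0" using u0 by simp
    then show ?thesis using False by (auto simp: minkowski_mult_vec vec_eq_iff)
  qed
  have fu: "\<forall>a. (minkowski ** K) *v u a = p a *\<^sub>R u a"
  proof -
    have "K *v u a = (if a = 0 then - p a else p a) *\<^sub>R u a" for a
      using u1 u2 u3 e0 exhaust_4[of a] by (auto simp: u_def p_def)
    then show ?thesis
      by (simp add: matrix_vector_mul_assoc[symmetric] matrix_vector_mult_scaleR mu)
  qed
  have TE: "T *v E a = p a *\<^sub>R E a" for a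
    using fu by (simp add: E_def matrix_vector_mul_assoc TM)
      (metis matrix_vector_mul_assoc matrix_vector_mult_scaleR)
  have gE: "ginner g (E a) (E b) = (if a \<noteq> b then 0 else if a = 0 then - 1 else 1)" for a b
  proof -
    have "ginner g (E a) (E b) = u a \<bullet> (minkowski *v u b)"
      unfolding E_def by (simp add: ginner_transpose frame)
    also have "minkowski *v u b = (if b = 0 then - u b else u b)"
      by (rule mu)
    finally show ?thesis using uorth by simp
  qed
  define P where "P = (\<chi> i a. E a $ i)"
  have "transpose P ** g ** P = minkowski"
  proof -
    have "(transpose P ** g ** P) $ a $ b = ginner g (E a) (E b)" for a b
      by (simp add: P_def ginner_def matrix_matrix_mult_def matrix_vector_mult_def transpose_def
          inner_vec_def sum_distrib_left sum_distrib_right mult.assoc) (rule sum.swap)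
    then show ?thesis by (simp add: gE vec_eq_iff minkowski_def)
  qed
  \<comment> \<open>Orthonormality already supplies a left inverse of the frame matrix, so the legs
    form a basis.\<close>
  then have "(minkowski ** transpose P ** g) ** P = mat 1"
    by (metis matrix_mul_assoc minkowski_square)
  then have inv: "invertible (\<chi> i a. E a $ i)"
    unfolding P_def[symmetric] by (metis invertible_left_inverse)
  have det: "det (mat x - T) = (x - p 0) * (x - p 1) * (x - p 2) * (x - p 3)" for x
    using eigenbasis_det_real_spectrum(1)[OF TE inv, of x] by (simp only: prod_index4)
  show "real_spectrum T" by (rule eigenbasis_det_real_spectrum(2)[OF TE inv])
  show "hawking_ellis_type_I g T"
    unfolding hawking_ellis_type_I_def
    by (rule exI[of _ "- p 0"], rule exI[of _ p], rule exI[of _ E]) (use det gE TE in auto)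
qed

section \<open>Curvature of a curl-free shift\<close>

text \<open>This relational form of \<open>partial\<close> includes existence, so a value obtained
  through it is never a default value of \<open>deriv\<close>.\<close>

definition has_partial :: "'n \<Rightarrow> (real^'n \<Rightarrow> real) \<Rightarrow> real \<Rightarrow> real^'n \<Rightarrow> bool"
  where "has_partial i f D x \<longleftrightarrow> ((\<lambda>h. f (x + h *\<^sub>R axis i 1)) has_real_derivative D) (at 0)"

lemma has_partial_imp_partial: "has_partial i f D x \<Longrightarrow> partial i f x = D"
  by (simp add: has_partial_def partial_def DERIV_imp_deriv)

lemma has_partial_eq: "has_partial i f D x \<Longrightarrow> D = E \<Longrightarrow> has_partial i f E x"
  by simp

lemma has_partial_const: "has_partial i (\<lambda>x. c) 0 x"
  by (simp add: has_partial_def)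

lemma has_partial_add:
  "has_partial i f D x \<Longrightarrow> has_partial i g E x \<Longrightarrow> has_partial i (\<lambda>x. f x + g x) (D + E) x"
  by (simp add: has_partial_def DERIV_add)

lemma has_partial_diff:
  "has_partial i f D x \<Longrightarrow> has_partial i g E x \<Longrightarrow> has_partial i (\<lambda>x. f x - g x) (D - E) x"
  by (simp add: has_partial_def DERIV_diff)

lemma has_partial_minus: "has_partial i f D x \<Longrightarrow> has_partial i (\<lambda>x. - f x) (- D) x"
  by (simp add: has_partial_def DERIV_minus)

lemma has_partial_mult:
  "has_partial i f D x \<Longrightarrow> has_partial i g E x \<Longrightarrow>
    has_partial i (\<lambda>x. f x * g x) (D * g x + E * f x) x"
  unfolding has_partial_def by (drule (1) DERIV_mult) simp

lemmas has_partial_intros = has_partial_const has_partial_add has_partial_diff has_partial_minus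
  has_partial_mult

section \<open>The flat-slice metric and its inverse\<close>

lemma matrix_inv_unique:
  fixes A B :: "real^'n^'n"
  assumes "A ** B = mat 1"
  shows "matrix_inv A = B"
proof -
  have "B ** A = mat 1" using assms matrix_left_right_inverse by blast
  then have "\<exists>B. A ** B = mat 1 \<and> B ** A = mat 1" using assms by blast
  from someI_ex[OF this] have "A ** matrix_inv A = mat 1" by (simp only: matrix_inv_def)
  then have "B ** A ** matrix_inv A = B" by (simp only: matrix_mul_assoc[symmetric] matrix_mul_rid)
  then show ?thesis by (simp add: \<open>B ** A = mat 1\<close>)
qed

text \<open>The zero time component lets the shift be summed over spacetime indices.\<close>

definition shift4 :: "shift_field \<Rightarrow> 4 \<Rightarrow> real^4 \<Rightarrow> real"
  where "shift4 \<beta> c p = event 0 (\<beta> (time_part p) (space_part p)) $ c"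

lemma shift4_0: "shift4 \<beta> 0 p = 0"
  by (simp add: shift4_def event_def)

lemma shift_metric_nth:
  "shift_metric \<beta> p $ a $ c =
    (if a = c then if a = 0 then - 1 else 1 else 0)
    + (if c = 0 then shift4 \<beta> a p else 0) + (if a = 0 then shift4 \<beta> c p else 0)
    + (if a = 0 \<and> c = 0 then shift4 \<beta> 1 p * shift4 \<beta> 1 p + shift4 \<beta> 2 p * shift4 \<beta> 2 p
         + shift4 \<beta> 3 p * shift4 \<beta> 3 p else 0)"
  by (induct a rule: index4_induct; induct c rule: index4_induct)
    (simp_all add: shift_metric_def shift_line_element_def Let_def inner_vec_def sum_3 time_part_def
      space_part_def shift4_def event_def axis_def algebra_simps)

lemma slice_normal_nth: "slice_normal \<beta> p $ a = (if a = 0 then 1 else - shift4 \<beta> a p)"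
  by (induct a rule: index4_induct) (simp_all add: slice_normal_def shift4_def event_def)

text \<open>The normal and the spatial axes are orthonormal, so the inverse metric is the sum of the
  squares of the spatial axes minus the square of the normal.\<close>

lemma matrix_inv_shift_metric:
  "matrix_inv (shift_metric \<beta> p) = (\<chi> a c. (if a = c \<and> a \<noteq> 0 then 1 else 0)
     - slice_normal \<beta> p $ a * slice_normal \<beta> p $ c)"
  by (rule matrix_inv_unique)
    (simp add: vec_eq_iff all_index4 matrix_matrix_mult_def sum_index4 shift_metric_nth
      slice_normal_nth mat_def shift4_0 algebra_simps)

text \<open>\<open>W a c\<close> stands for \<open>\<partial>\<^sub>a \<beta>\<^sub>c\<close>, with \<open>\<beta>\<^sub>0 = 0\<close>, and \<open>Z a b c\<close> for \<open>\<partial>\<^sub>a \<partial>\<^sub>b \<beta>\<^sub>c\<close> with \<open>b\<close>, \<open>c\<close> spatial.\<close>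

locale curl_free_shift =
  fixes \<beta> :: shift_field and W :: "4 \<Rightarrow> 4 \<Rightarrow> real^4 \<Rightarrow> real"
    and Z :: "4 \<Rightarrow> 4 \<Rightarrow> 4 \<Rightarrow> real^4 \<Rightarrow> real"
  assumes has_partial_shift: "has_partial a (shift4 \<beta> c) (W a c p) p"
    and has_partial_W: "b \<noteq> 0 \<Longrightarrow> c \<noteq> 0 \<Longrightarrow> has_partial a (W b c) (Z a b c p) p"
    and W_sym: "b \<noteq> 0 \<Longrightarrow> c \<noteq> 0 \<Longrightarrow> W b c p = W c b p"
begin

abbreviation "B \<equiv> shift4 \<beta>"
abbreviation "g \<equiv> shift_metric \<beta>"
abbreviation "n \<equiv> slice_normal \<beta>"

section \<open>Christoffel symbols\<close>

lemma W_0: "W a 0 p = 0"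
  using has_partial_imp_partial[OF has_partial_shift[of a 0 p]]
    has_partial_imp_partial[OF has_partial_const[of a 0 p]]
  by (simp add: shift4_0[abs_def])

text \<open>The derivative of the shift along itself; for spatial \<open>i\<close> the symmetry of
  \<open>W\<close> makes it half the gradient of the squared length of the shift.\<close>

definition U :: "4 \<Rightarrow> real^4 \<Rightarrow> real"
  where "U i p = B 1 p * W 1 i p + B 2 p * W 2 i p + B 3 p * W 3 i p"

text \<open>The spacetime extension of the symmetric tensor \<open>\<partial>\<^sub>i \<beta>\<^sub>j\<close> (up to sign the extrinsic
  curvature) that annihilates the slice normal.\<close>

definition sig :: "4 \<Rightarrow> 4 \<Rightarrow> real^4 \<Rightarrow> real"
  where "sig b c p =
    (if b = 0 then if c = 0 then B 1 p * U 1 p + B 2 p * U 2 p + B 3 p * U 3 p else U c p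
     else if c = 0 then U b p else W b c p)"

definition acc :: "4 \<Rightarrow> real^4 \<Rightarrow> real"
  where "acc a p = (if a = 0 then 0 else W 0 a p - U a p)"

lemma partial_metric:
  "partial a (\<lambda>q. g q $ d $ c) p =
    (if c = 0 then W a d p else 0) + (if d = 0 then W a c p else 0)
    + (if d = 0 \<and> c = 0 then 2 * (B 1 p * W a 1 p + B 2 p * W a 2 p + B 3 p * W a 3 p) else 0)"
proof (cases "c = 0 \<and> d = 0")
  case True
  show ?thesis unfolding shift_metric_nth using True
    by (intro has_partial_imp_partial, simp)
      (rule has_partial_eq, (rule has_partial_intros has_partial_shift)+,
        simp add: algebra_simps W_0)
next
  case False
  then show ?thesis unfolding shift_metric_nth
    by (intro has_partial_imp_partial) (auto intro: has_partial_shift has_partial_const)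
qed

text \<open>Rotation terms, built from differences \<open>W b c p - W c b p\<close> with spatial
  indices, would spoil this form; \<open>W_sym\<close> cancels them. All 64 index triples are
  checked.\<close>

lemma christoffel_eq:
  "christoffel g a b c p = (if b = 0 \<and> c = 0 then acc a p else 0) - n p $ a * sig b c p"
proof -
  note Ws = W_sym[of 2 1 p, simplified] W_sym[of 3 1 p, simplified] W_sym[of 3 2 p, simplified]
  show ?thesis
    by (induct a rule: index4_induct; induct b rule: index4_induct; induct c rule: index4_induct)
      (simp add: christoffel_def sum_index4 matrix_inv_shift_metric slice_normal_nth partial_metric
        W_0 shift4_0 acc_def sig_def U_def Ws, (simp add: field_simps)?)+
qed

end

text \<open>This evaluates the product of Christoffel symbols in the Ricci tensor, \<open>D\<close>
  and \<open>E\<close> standing for \<open>d = 0\<close> and \<open>b = 0\<close>. The term with two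
  factors \<open>A\<close> contains \<open>A 0\<close>, the one with two factors \<open>n\<close>
  contains the vanishing contractions, and \<open>n 0 = 1\<close> evaluates the mixed ones.\<close>

lemma contraction_identity:
  fixes n s t A :: "4 \<Rightarrow> real"
  assumes "n 0 = 1" "A 0 = 0" "(\<Sum>a\<in>UNIV. n a * s a) = 0" "(\<Sum>a\<in>UNIV. n a * t a) = 0"
  shows "(\<Sum>a\<in>UNIV. \<Sum>e\<in>UNIV. ((if D \<and> e = 0 then A a else 0) - n a * s e)
            * ((if a = 0 \<and> E then A e else 0) - n e * t a))
    = - (if D then \<Sum>a\<in>UNIV. A a * t a else 0) - (if E then \<Sum>a\<in>UNIV. A a * s a else 0)"
proof -
  have s0: "s 0 = - (n 1 * s 1 + n 2 * s 2 + n 3 * s 3)"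
    and t0: "t 0 = - (n 1 * t 1 + n 2 * t 2 + n 3 * t 3)"
    using assms by (simp_all add: sum_index4)
  show ?thesis
    by (cases D; cases E) (simp_all add: sum_index4 assms(1,2) s0 t0 algebra_simps)
qed

section \<open>The Ricci tensor\<close>

context curl_free_shift
begin

text \<open>\<open>dU\<close> and \<open>dsig\<close> are bracketed as
  \<open>has_partial_mult\<close> delivers its results, so the derivative rules below apply without
  rearrangement.\<close>

definition dU :: "4 \<Rightarrow> 4 \<Rightarrow> real^4 \<Rightarrow> real"
  where "dU a i p = (W a 1 p * W 1 i p + Z a 1 i p * B 1 p) + (W a 2 p * W 2 i p + Z a 2 i p * B 2 p)
    + (W a 3 p * W 3 i p + Z a 3 i p * B 3 p)"

definition dsig :: "4 \<Rightarrow> 4 \<Rightarrow> 4 \<Rightarrow> real^4 \<Rightarrow> real"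
  where "dsig a b c p =
    (if b = 0 then
       if c = 0 then (W a 1 p * U 1 p + dU a 1 p * B 1 p) + (W a 2 p * U 2 p + dU a 2 p * B 2 p)
         + (W a 3 p * U 3 p + dU a 3 p * B 3 p)
       else dU a c p
     else if c = 0 then dU a b p else Z a b c p)"

lemma has_partial_U: "i \<noteq> 0 \<Longrightarrow> has_partial a (U i) (dU a i p) p"
  unfolding U_def[abs_def] dU_def
  by (intro has_partial_add has_partial_mult has_partial_shift has_partial_W) simp_all

lemma has_partial_sig: "has_partial a (sig b c) (dsig a b c p) p"
  by (cases "b = 0"; cases "c = 0")
    (auto simp: sig_def[abs_def] dsig_def intro!: has_partial_add has_partial_mult has_partial_shift
      has_partial_U has_partial_W)

lemma has_partial_normal: "has_partial a (\<lambda>p. n p $ c) (- W a c p) p"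
  by (cases "c = 0")
    (simp_all add: slice_normal_nth W_0 has_partial_const has_partial_minus has_partial_shift)

lemma sig_sym: "sig b c p = sig c b p"
  by (simp add: sig_def W_sym)

lemma normal_sig: "(\<Sum>a\<in>UNIV. n p $ a * sig a b p) = 0"
  by (induct b rule: index4_induct) (simp_all add: sum_index4 slice_normal_nth sig_def U_def)

text \<open>Differentiate \<open>normal_sig\<close>; the normal contributes the derivative
  \<open>- W a c p\<close>.\<close>

lemma normal_dsig: "(\<Sum>c\<in>UNIV. n p $ c * dsig a c b p) = (\<Sum>c\<in>UNIV. W a c p * sig c b p)"
proof -
  have "has_partial a (\<lambda>p. n p $ 0 * sig 0 b p + n p $ 1 * sig 1 b p + n p $ 2 * sig 2 b p
      + n p $ 3 * sig 3 b p)
    (- W a 0 p * sig 0 b p + dsig a 0 b p * n p $ 0 + (- W a 1 p * sig 1 b p + dsig a 1 b p * n p $ 1)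
      + (- W a 2 p * sig 2 b p + dsig a 2 b p * n p $ 2)
      + (- W a 3 p * sig 3 b p + dsig a 3 b p * n p $ 3)) p"
    by (intro has_partial_add has_partial_mult has_partial_sig has_partial_normal)
  moreover have "(\<lambda>p. n p $ 0 * sig 0 b p + n p $ 1 * sig 1 b p + n p $ 2 * sig 2 b p
      + n p $ 3 * sig 3 b p) = (\<lambda>p. 0)"
    using normal_sig by (simp add: sum_index4)
  ultimately show ?thesis
    using has_partial_imp_partial[of a "\<lambda>p. 0" _ p] has_partial_imp_partial[OF has_partial_const[of a 0 p]]
    by (fastforce simp: sum_index4 algebra_simps)
qed

lemma acc_eq: "acc a p = (\<Sum>c\<in>UNIV. n p $ c * W c a p)"
  by (cases "a = 0") (simp_all add: acc_def sum_index4 slice_normal_nth U_def W_0)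

text \<open>The acceleration enters a traced symbol only at \<open>a = 0\<close>, where
  \<open>acc\<close> is zero; the rest is the contraction in \<open>normal_sig\<close>.\<close>

lemma christoffel_trace: "(\<Sum>a\<in>UNIV. christoffel g a a b p) = 0"
proof -
  have "christoffel g a a b p = - (n p $ a * sig a b p)" for a
    by (simp add: christoffel_eq acc_def)
  then show ?thesis by (simp add: sum_negf normal_sig)
qed

lemma has_partial_christoffel_diag:
  "has_partial d (christoffel g a a b) (W d a p * sig a b p - dsig d a b p * n p $ a) p"
proof -
  have "christoffel g a a b = (\<lambda>p. - (n p $ a * sig a b p))"
    by (auto simp: christoffel_eq acc_def)
  then show ?thesis
    by (simp, intro has_partial_eq[OF has_partial_minus[OF has_partial_mult[OF has_partial_normal
      has_partial_sig]]]) simp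
qed

text \<open>The two Ricci terms with a traced Christoffel symbol vanish, the differentiated one by
  \<open>normal_dsig\<close> and the product by \<open>christoffel_trace\<close>. The other product
  is evaluated by \<open>contraction_identity\<close>.\<close>

lemma ricci_eq:
  "ricci g p $ b $ d = (\<Sum>a\<in>UNIV. partial a (christoffel g a d b) p)
     + (if d = 0 then \<Sum>a\<in>UNIV. acc a p * sig a b p else 0)
     + (if b = 0 then \<Sum>a\<in>UNIV. acc a p * sig a d p else 0)"
proof -
  have 1: "(\<Sum>a\<in>UNIV. partial d (christoffel g a a b) p) = 0"
    using normal_dsig[of p d b]
    by (simp add: has_partial_imp_partial[OF has_partial_christoffel_diag] sum_subtractf mult.commute)
  have 2: "(\<Sum>a\<in>UNIV. \<Sum>e\<in>UNIV. christoffel g a a e p * christoffel g e d b p) = 0"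
    by (subst sum.swap) (simp add: sum_distrib_right[symmetric] christoffel_trace)
  have 3: "(\<Sum>a\<in>UNIV. \<Sum>e\<in>UNIV. christoffel g a d e p * christoffel g e a b p)
    = - (if d = 0 then \<Sum>a\<in>UNIV. acc a p * sig a b p else 0)
      - (if b = 0 then \<Sum>a\<in>UNIV. acc a p * sig a d p else 0)"
    unfolding christoffel_eq sig_sym[of d]
    by (rule contraction_identity[OF _ _ normal_sig normal_sig])
      (simp_all add: slice_normal_nth acc_def)
  show ?thesis
    by (simp add: ricci_def riemann_def sum.distrib sum_subtractf 1 2 3)
qed

lemma christoffel_sym: "christoffel g a b c = christoffel g a c b"
  by (auto simp: christoffel_eq sig_sym[of b c])

lemma ricci_sym: "ricci g p $ b $ d = ricci g p $ d $ b"
  by (simp add: ricci_eq christoffel_sym[of _ b d])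

text \<open>\<open>acc\<close> contains \<open>W 0\<close>, about whose derivatives the locale says
  nothing. A spatial \<open>b\<close> keeps \<open>acc\<close> out of the symbol; only the time-time
  Ricci component stays unevaluated.\<close>

lemma partial_christoffel:
  assumes "b \<noteq> 0"
  shows "partial a (christoffel g a c b) p = W a a p * sig c b p - dsig a c b p * n p $ a"
proof -
  have "christoffel g a c b = (\<lambda>p. - (n p $ a * sig c b p))"
    using assms by (auto simp: christoffel_eq)
  then show ?thesis
    by (simp, intro has_partial_imp_partial has_partial_eq[OF has_partial_minus[OF has_partial_mult[OF
      has_partial_normal has_partial_sig]]]) simp
qed

text \<open>No commutation of second derivatives is needed: as \<open>\<Gamma>\<^sup>a\<^sub>a\<^sub>b = 0\<close>, the Ricci tensor contains second
  derivatives of the shift only through \<open>\<partial>\<^sub>a \<sigma>\<^sub>b\<^sub>c\<close>, and \<open>n\<^sup>b \<sigma>\<^sub>b\<^sub>c = 0\<close> trades those for products of first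
  derivatives.\<close>

lemma ricci_normal:
  assumes "i \<noteq> 0"
  shows "(\<Sum>b\<in>UNIV. ricci g p $ i $ b * n p $ b) = 0"
proof -
  have "(\<Sum>b\<in>UNIV. ricci g p $ i $ b * n p $ b) =
      (\<Sum>b\<in>UNIV. (\<Sum>a\<in>UNIV. W a a p * sig b i p - dsig a b i p * n p $ a) * n p $ b)
      + (\<Sum>a\<in>UNIV. acc a p * sig a i p)"
    using assms by (simp add: ricci_eq partial_christoffel sum_index4 slice_normal_nth algebra_simps)
  also have "(\<Sum>b\<in>UNIV. (\<Sum>a\<in>UNIV. W a a p * sig b i p - dsig a b i p * n p $ a) * n p $ b)
      = (\<Sum>a\<in>UNIV. W a a p * (\<Sum>b\<in>UNIV. n p $ b * sig b i p)
          - n p $ a * (\<Sum>b\<in>UNIV. n p $ b * dsig a b i p))"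
    unfolding sum_distrib_right by (subst sum.swap) (simp add: sum_distrib_left sum_subtractf[symmetric] algebra_simps)
  also have "\<dots> = - (\<Sum>a\<in>UNIV. n p $ a * (\<Sum>c\<in>UNIV. W a c p * sig c i p))"
    by (simp add: normal_sig normal_dsig sum_negf)
  also have "(\<Sum>a\<in>UNIV. n p $ a * (\<Sum>c\<in>UNIV. W a c p * sig c i p))
      = (\<Sum>c\<in>UNIV. acc c p * sig c i p)"
    unfolding sum_distrib_left by (subst sum.swap) (simp add: acc_eq sum_distrib_right mult.assoc)
  finally show ?thesis by simp
qed

end

section \<open>The stress-energy tensor in the Eulerian frame\<close>

lemma metric_slice_normal: "shift_metric \<beta> p *v slice_normal \<beta> p = - axis 0 1"
  by (simp add: vec_eq_iff all_index4 matrix_vector_mult_def sum_index4 shift_metric_nth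
      slice_normal_nth shift4_0 axis_def algebra_simps)

lemma slice_projector_nth:
  "slice_projector \<beta> p $ a $ c = (if a = c then 1 else 0) - (if c = 0 then slice_normal \<beta> p $ a else 0)"
  by (simp add: slice_projector_def metric_slice_normal mat_def axis_def)

lemma eulerian_frame_metric:
  "transpose (eulerian_frame \<beta> p) ** shift_metric \<beta> p ** eulerian_frame \<beta> p = minkowski"
  by (simp add: vec_eq_iff all_index4 matrix_matrix_mult_def sum_index4 shift_metric_nth transpose_def
      slice_normal_nth shift4_0 axis_def eulerian_frame_def minkowski_def algebra_simps)

lemma matrix_inv_shift_metric_frame:
  "matrix_inv (shift_metric \<beta> p) =
    eulerian_frame \<beta> p ** minkowski ** transpose (eulerian_frame \<beta> p)"
  by (simp add: matrix_inv_shift_metric vec_eq_iff all_index4 matrix_matrix_mult_def sum_index4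
      transpose_def slice_normal_nth axis_def eulerian_frame_def minkowski_def)

lemma matrix_inv_eulerian_frame: "matrix_inv (eulerian_frame \<beta> p) ** eulerian_frame \<beta> p = mat 1"
proof -
  define Q :: "real^4^4" where
    "Q = (\<chi> a c. (if a = c then 1 else 0) - (if a \<noteq> 0 \<and> c = 0 then slice_normal \<beta> p $ a else 0))"
  have "eulerian_frame \<beta> p ** Q = mat 1"
    by (simp add: Q_def vec_eq_iff all_index4 matrix_matrix_mult_def sum_index4 slice_normal_nth
        eulerian_frame_def axis_def mat_def)
  then show ?thesis using matrix_inv_unique matrix_left_right_inverse by metis
qed

context curl_free_shift
begin

lemma stress_energy_sym: "stress_energy g p $ b $ d = stress_energy g p $ d $ b"
proof -
  have "g p $ b $ d = g p $ d $ b" by (simp add: shift_metric_nth)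
  then show ?thesis by (simp add: stress_energy_def einstein_def ricci_sym[of p b d])
qed

text \<open>Lowering the index of \<open>n\<close> gives a multiple of \<open>dt\<close>, so the
  metric term of the Einstein tensor reaches only the time component, and
  \<open>ricci_normal\<close> removes the spatial ones. As \<open>n\<close> has time component 1,
  what remains is the energy density.\<close>

lemma stress_energy_normal:
  "stress_energy g p *v n p = energy_density \<beta> p *\<^sub>R axis 0 1"
proof -
  have X: "stress_energy g p *v n p =
      (1 / (8 * pi)) *\<^sub>R (ricci g p *v n p + (scalar_curvature g p / 2) *\<^sub>R axis 0 1)"
    by (simp add: stress_energy_def einstein_def scaleR_matrix_vector_assoc[symmetric]
        matrix_vector_mult_diff_rdistrib metric_slice_normal)
  have "(stress_energy g p *v n p) $ i = 0" if "i \<noteq> 0" for i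
    using ricci_normal[OF that, of p] that unfolding X
    by (simp add: matrix_vector_mult_def axis_def)
  moreover from this have "energy_density \<beta> p = (stress_energy g p *v n p) $ 0"
    by (simp add: energy_density_def inner_vec_def sum_index4 slice_normal_nth)
  ultimately show ?thesis by (simp add: vec_eq_iff axis_def)
qed

lemma mixed_stress_energy_normal:
  "mixed_stress_energy g p *v n p = - energy_density \<beta> p *\<^sub>R n p"
proof -
  have "matrix_inv (g p) *v axis 0 1 = - n p"
    by (simp add: matrix_inv_shift_metric vec_eq_iff all_index4 matrix_vector_mult_def sum_index4
        axis_def slice_normal_nth)
  then show ?thesis
    by (simp add: mixed_stress_energy_def matrix_vector_mul_assoc[symmetric] stress_energy_normal
        matrix_vector_mult_scaleR)
qed

text \<open>The energy flux is parallel to \<open>n\<close>, which the projector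
  annihilates.\<close>

lemma momentum_density_zero: "momentum_density \<beta> p = 0"
proof -
  have "slice_projector \<beta> p *v n p = 0"
    by (simp add: vec_eq_iff all_index4 matrix_vector_mult_def sum_index4 slice_projector_nth
        slice_normal_nth)
  then show ?thesis
    by (simp only: momentum_density_def mixed_stress_energy_normal matrix_vector_mult_scaleR
        scaleR_zero_right minus_zero)
qed

lemma timelike_normal: "timelike_eigenvector (g p) (mixed_stress_energy g p) (n p)"
proof -
  have "ginner (g p) (n p) (n p) = - 1"
    by (simp add: ginner_def metric_slice_normal inner_axis slice_normal_nth)
  then show ?thesis
    using mixed_stress_energy_normal[of p] by (auto simp only: timelike_eigenvector_def)
qed

definition frame_stress :: "real^4 \<Rightarrow> real^4^4"
  where "frame_stress p =
    transpose (eulerian_frame \<beta> p) ** stress_energy g p ** eulerian_frame \<beta> p"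

text \<open>Since the frame is orthonormal, the inverse metric factors through it and
  \<open>minkowski\<close>; this supplies the shape needed by
  \<open>type_I_of_block_diagonal\<close>.\<close>

lemma mixed_stress_energy_frame:
  "mixed_stress_energy g p ** eulerian_frame \<beta> p =
    eulerian_frame \<beta> p ** (minkowski ** frame_stress p)"
  by (simp only: mixed_stress_energy_def matrix_inv_shift_metric_frame frame_stress_def
      matrix_mul_assoc)

lemma frame_stress_sym: "transpose (frame_stress p) = frame_stress p"
proof -
  have "transpose (stress_energy g p) = stress_energy g p"
    by (simp add: vec_eq_iff transpose_def stress_energy_sym)
  then show ?thesis
    by (simp add: frame_stress_def matrix_transpose_mul transpose_transpose matrix_mul_assoc)
qed

text \<open>The zeroth frame vector is \<open>n\<close>, covered by
  \<open>stress_energy_normal\<close>; the others are coordinate axes, which leave the entries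
  unchanged.\<close>

lemma frame_stress_nth:
  "frame_stress p $ a $ c = (if a = 0 \<and> c = 0 then energy_density \<beta> p
     else if a = 0 \<or> c = 0 then 0 else stress_energy g p $ a $ c)"
proof -
  have 0: "frame_stress p $ a $ 0 = (if a = 0 then energy_density \<beta> p else 0)" for a
  proof -
    have "frame_stress p $ a $ 0 = (\<Sum>b\<in>UNIV. eulerian_frame \<beta> p $ b $ a * (stress_energy g p *v n p) $ b)"
      unfolding frame_stress_def matrix_mul_assoc[symmetric]
      by (simp add: matrix_matrix_mult_def transpose_def eulerian_frame_def matrix_vector_mult_def)
    then show ?thesis
      by (simp add: stress_energy_normal sum_index4 axis_def eulerian_frame_def slice_normal_nth)
  qed
  have sym: "frame_stress p $ a $ c = frame_stress p $ c $ a"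
    using arg_cong[OF frame_stress_sym[of p], of "\<lambda>X. X $ a $ c"] by (simp add: transpose_def)
  have "\<forall>a c. a \<noteq> 0 \<longrightarrow> c \<noteq> 0 \<longrightarrow> frame_stress p $ a $ c = stress_energy g p $ a $ c"
    unfolding all_index4 by (simp add: frame_stress_def matrix_matrix_mult_def sum_index4
        transpose_def eulerian_frame_def axis_def)
  then show ?thesis using 0[of a] 0[of c] sym by auto
qed

lemma spatial_stress_nth:
  assumes "a \<noteq> 0" "c \<noteq> 0"
  shows "spatial_stress \<beta> p $ a $ c = stress_energy g p $ a $ c"
proof -
  have "\<forall>a c. a \<noteq> 0 \<longrightarrow> c \<noteq> 0 \<longrightarrow> spatial_stress \<beta> p $ a $ c = stress_energy g p $ a $ c"
    unfolding all_index4 by (simp add: spatial_stress_def matrix_matrix_mult_def sum_index4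
        transpose_def slice_projector_nth)
  then show ?thesis using assms by blast
qed

lemma block_diagonal: "eulerian_block_diagonal \<beta> p"
proof -
  have "matrix_inv (eulerian_frame \<beta> p) ** mixed_stress_energy g p ** eulerian_frame \<beta> p
      = minkowski ** frame_stress p"
    by (simp only: matrix_mul_assoc[symmetric] mixed_stress_energy_frame)
      (simp only: matrix_mul_assoc matrix_inv_eulerian_frame matrix_mul_lid)
  also have "\<dots> = (\<chi> a c. if a = 0 \<and> c = 0 then - energy_density \<beta> p
      else if a = 0 \<or> c = 0 then 0 else spatial_stress \<beta> p $ a $ c)"
    by (simp add: vec_eq_iff all_index4 matrix_matrix_mult_def sum_index4 minkowski_def
        frame_stress_nth spatial_stress_nth)
  finally show ?thesis
    by (simp add: eulerian_block_diagonal_def spatial_stress_nth stress_energy_sym)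
qed

lemma type_I: "hawking_ellis_type_I (g p) (mixed_stress_energy g p)"
  and real_spectrum: "real_spectrum (mixed_stress_energy g p)"
  using type_I_of_block_diagonal[OF eulerian_frame_metric mixed_stress_energy_frame frame_stress_sym]
  by (simp_all add: frame_stress_nth)

end

section \<open>Even profiles\<close>

text \<open>Dividing each derivative by \<open>r\<close> makes \<open>f (norm y)\<close> differentiable at the origin too. For even
  functions this loses nothing: \<open>f' r / r\<close> is the mean of \<open>f''\<close> over \<open>[0, r]\<close>.\<close>

primrec even_smooth :: "nat \<Rightarrow> (real \<Rightarrow> real) \<Rightarrow> bool" where
  "even_smooth 0 f \<longleftrightarrow> continuous_on UNIV f"
| "even_smooth (Suc n) f \<longleftrightarrow>
     (\<exists>g. even_smooth n g \<and> (\<forall>r. (f has_real_derivative r * g r) (at r)))"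

lemma even_smooth_continuous_on: "even_smooth n f \<Longrightarrow> continuous_on UNIV f"
proof (cases n)
  case (Suc m)
  moreover assume "even_smooth n f"
  ultimately obtain g where "\<And>r. (f has_real_derivative r * g r) (at r)" by auto
  then show ?thesis by (meson DERIV_isCont continuous_at_imp_continuous_on)
qed simp

lemma even_smooth_SucD: "even_smooth (Suc n) f \<Longrightarrow> even_smooth n f"
proof (induction n arbitrary: f)
  case 0
  then show ?case using even_smooth_continuous_on[of 1 f] by simp
next
  case (Suc n)
  then show ?case by (metis even_smooth.simps(2))
qed

lemma even_smooth_const: "even_smooth n (\<lambda>r. c)"
proof (induction n arbitrary: c)
  case (Suc n)
  show ?case using Suc[of 0] by (auto intro!: exI[of _ "\<lambda>r. 0"])
qed simp

lemma even_smooth_add: "even_smooth n f \<Longrightarrow> even_smooth n g \<Longrightarrow> even_smooth n (\<lambda>r. f r + g r)"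
proof (induction n arbitrary: f g)
  case (Suc n)
  then obtain f' g' where *: "even_smooth n f'" "even_smooth n g'"
    "\<And>r. (f has_real_derivative r * f' r) (at r)" "\<And>r. (g has_real_derivative r * g' r) (at r)"
    by auto
  have "\<forall>r. ((\<lambda>r. f r + g r) has_real_derivative r * (f' r + g' r)) (at r)"
    using * by (auto intro!: derivative_eq_intros simp: algebra_simps)
  then show ?case using Suc.IH[OF *(1,2)] unfolding even_smooth.simps by blast
qed (auto intro: continuous_intros)

lemma even_smooth_mult: "even_smooth n f \<Longrightarrow> even_smooth n g \<Longrightarrow> even_smooth n (\<lambda>r. f r * g r)"
proof (induction n arbitrary: f g)
  case (Suc n)
  then obtain f' g' where *: "even_smooth n f'" "even_smooth n g'"
    "\<And>r. (f has_real_derivative r * f' r) (at r)" "\<And>r. (g has_real_derivative r * g' r) (at r)"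
    by auto
  have "\<forall>r. ((\<lambda>r. f r * g r) has_real_derivative r * (f' r * g r + f r * g' r)) (at r)"
    using * by (auto intro!: derivative_eq_intros simp: algebra_simps)
  moreover have "even_smooth n (\<lambda>r. f' r * g r + f r * g' r)"
    using Suc * even_smooth_SucD by (intro even_smooth_add Suc.IH) auto
  ultimately show ?case unfolding even_smooth.simps by blast
qed (auto intro: continuous_intros)

lemma even_smooth_inverse:
  assumes "\<And>r. f r \<noteq> 0"
  shows "even_smooth n f \<Longrightarrow> even_smooth n (\<lambda>r. inverse (f r))"
proof (induction n)
  case (Suc n)
  then obtain f' where *: "even_smooth n f'" "\<And>r. (f has_real_derivative r * f' r) (at r)"
    by auto
  have "\<forall>r. ((\<lambda>r. inverse (f r)) has_real_derivative
      r * (- 1 * f' r * (inverse (f r) * inverse (f r)))) (at r)"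
    using * assms by (auto intro!: derivative_eq_intros simp: algebra_simps)
  moreover have "even_smooth n (\<lambda>r. - 1 * f' r * (inverse (f r) * inverse (f r)))"
    using Suc * even_smooth_SucD by (intro even_smooth_mult even_smooth_const) auto
  ultimately show ?case unfolding even_smooth.simps by blast
qed (use assms in \<open>auto intro: continuous_intros\<close>)

lemma DERIV_compose_cmult:
  fixes k r :: real
  assumes "(f has_real_derivative D) (at (k * r))"
  shows "((\<lambda>r. f (k * r)) has_real_derivative D * k) (at r)"
  by (rule DERIV_chain2[where g = "\<lambda>r. k * r", OF assms]) (auto intro!: derivative_eq_intros)

lemma even_smooth_scale: "even_smooth n f \<Longrightarrow> even_smooth n (\<lambda>r. f (k * r))"
proof (induction n arbitrary: f)
  case 0
  then show ?case by (auto intro!: continuous_intros elim: continuous_on_compose2)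
next
  case (Suc n)
  then obtain f' where *: "even_smooth n f'" "\<And>r. (f has_real_derivative r * f' r) (at r)"
    by auto
  have "((\<lambda>r. f (k * r)) has_real_derivative r * (k * k * f' (k * r))) (at r)" for r
    using DERIV_compose_cmult[OF *(2)[of "k * r"]] by (simp add: mult_ac)
  moreover have "even_smooth n (\<lambda>r. k * k * f' (k * r))"
    using Suc.IH[OF *(1)] by (intro even_smooth_mult even_smooth_const)
  ultimately show ?case unfolding even_smooth.simps by blast
qed

text \<open>The exponent \<open>m\<close> has to vary in the induction: differentiating under the
  integral brings one factor \<open>s\<close> from the chain rule and one from the argument
  \<open>s * r\<close>, while the factor \<open>r\<close> demanded by \<open>even_smooth\<close>
  comes out in front.\<close>

lemma even_smooth_average:
  "even_smooth n f \<Longrightarrow> even_smooth n (\<lambda>r. integral {0..1} (\<lambda>s. s ^ m * f (s * r)))"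
proof (induction n arbitrary: f m)
  case 0
  then have [continuous_intros]: "continuous_on S h \<Longrightarrow> continuous_on S (\<lambda>x. f (h x))" for S h
    by (auto elim: continuous_on_compose2)
  have "continuous_on (UNIV \<times> cbox 0 1) (\<lambda>(r, s). s ^ m * f (s * r))"
    by (auto simp: split_beta intro!: continuous_intros)
  from integral_continuous_on_param[OF this] show ?case by simp
next
  case (Suc n)
  then obtain f' where *: "even_smooth n f'" "\<And>r. (f has_real_derivative r * f' r) (at r)"
    by auto
  have cf: "continuous_on S h \<Longrightarrow> continuous_on S (\<lambda>x. f (h x))" for S and h :: "real \<Rightarrow> real"
    using even_smooth_continuous_on[OF Suc.prems] by (auto elim: continuous_on_compose2)
  have cf': "continuous_on S h \<Longrightarrow> continuous_on S (\<lambda>x. f' (h x))" for S and h :: "real \<times> real \<Rightarrow> real"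
    using even_smooth_continuous_on[OF *(1)] by (auto elim: continuous_on_compose2)
  have "((\<lambda>r. integral (cbox 0 1) (\<lambda>s. s ^ m * f (s * r))) has_real_derivative
      integral (cbox 0 1) (\<lambda>s. r * (s ^ (m + 2) * f' (s * r)))) (at r)" for r
  proof (rule leibniz_rule_field_derivative[where U = UNIV])
    fix r s :: real
    show "((\<lambda>r. s ^ m * f (s * r)) has_real_derivative r * (s ^ (m + 2) * f' (s * r))) (at r)"
      using DERIV_cmult[OF DERIV_compose_cmult[OF *(2)[of "s * r"]], of "s ^ m"]
      by (simp add: mult_ac power2_eq_square power_add)
    show "(\<lambda>s. s ^ m * f (s * r)) integrable_on cbox 0 1"
      by (intro integrable_continuous continuous_intros cf)
    show "continuous_on (UNIV \<times> cbox 0 1) (\<lambda>(r, s). r * (s ^ (m + 2) * f' (s * r)))"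
      by (auto simp: split_beta intro!: continuous_intros cf')
  qed auto
  then have "\<forall>r. ((\<lambda>r. integral {0..1} (\<lambda>s. s ^ m * f (s * r))) has_real_derivative
      r * integral {0..1} (\<lambda>s. s ^ (m + 2) * f' (s * r))) (at r)"
    by simp
  then show ?case using Suc.IH[OF *(1)] unfolding even_smooth.simps by blast
qed

text \<open>The fundamental theorem of calculus for \<open>f (s * r)\<close> as a function of
  \<open>s\<close> on the unit interval.\<close>

lemma average_deriv:
  fixes f f' :: "real \<Rightarrow> real"
  assumes "\<And>r. (f has_real_derivative f' r) (at r)" "f 0 = 0"
  shows "r * integral {0..1} (\<lambda>s. f' (s * r)) = f r"
proof -
  have "((\<lambda>s. r * f' (s * r)) has_integral f (1 * r) - f (0 * r)) {0..1}"
  proof (rule fundamental_theorem_of_calculus)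
    fix s :: real
    have "((\<lambda>s. f (s * r)) has_real_derivative r * f' (s * r)) (at s)"
      using DERIV_compose_cmult[OF assms(1)[of "r * s"]] by (simp add: mult_ac)
    then show "((\<lambda>s. f (s * r)) has_vector_derivative r * f' (s * r)) (at s within {0..1})"
      by (simp add: has_real_derivative_iff_has_vector_derivative has_vector_derivative_at_within)
  qed simp
  from integral_unique[OF this] show ?thesis
    by (simp only: integral_mult_right) (simp add: assms(2))
qed

text \<open>The derivative \<open>sinh r\<close> is \<open>r\<close> times the average of
  \<open>cosh (s * r)\<close>, which inherits its order from \<open>cosh\<close>.\<close>

lemma even_smooth_cosh: "even_smooth n cosh"
proof (induction n)
  case (Suc n)
  have "r * integral {0..1} (\<lambda>s. cosh (s * r)) = sinh r" for r :: real
    by (rule average_deriv) (auto intro!: derivative_eq_intros)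
  then have "\<forall>r. (cosh has_real_derivative r * integral {0..1} (\<lambda>s. s ^ 0 * cosh (s * r))) (at r)"
    by (auto intro!: derivative_eq_intros)
  then show ?case using even_smooth_average[OF Suc, of 0] unfolding even_smooth.simps by blast
qed (auto intro!: continuous_intros)

section \<open>Radial functions\<close>

lemma has_derivative_radial:
  fixes y :: "'a::real_inner"
  assumes "(f has_real_derivative D) (at (norm y))" and "y \<noteq> 0"
  shows "((\<lambda>y. f (norm y)) has_derivative (\<lambda>d. D / norm y * (y \<bullet> d))) (at y)"
proof -
  have "((\<lambda>y. f (norm y)) has_derivative (\<lambda>d. D * (d \<bullet> sgn y))) (at y)"
    using has_derivative_compose[OF has_derivative_norm[of y]
        assms(1)[unfolded has_field_derivative_def]] assms(2) by simp
  then show ?thesis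
    by (rule has_derivative_eq_rhs) (simp add: fun_eq_iff sgn_div_norm inner_commute field_simps)
qed

text \<open>Away from 0 this is the chain rule. At 0 the norm is not differentiable, but the factor
  \<open>r\<close> makes the derivative of \<open>f\<close> vanish there, so the difference
  quotients tend to 0.\<close>

lemma has_derivative_even_norm:
  fixes y :: "'a::real_inner"
  assumes f: "\<And>r. (f has_real_derivative r * g r) (at r)"
  shows "((\<lambda>y. f (norm y)) has_derivative (\<lambda>d. g (norm y) * (y \<bullet> d))) (at y)"
proof (cases "y = 0")
  case False
  then show ?thesis using has_derivative_radial[OF f[of "norm y"] False] by simp
next
  case True
  have "(\<lambda>h. (f h - f 0) / h) \<midarrow>0\<rightarrow> 0"
    using f[of 0] by (simp add: has_field_derivative_iff)
  moreover have "filterlim norm (at 0) (at (0::'a))"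
    by (auto simp: filterlim_at eventually_at intro!: tendsto_eq_intros exI[of _ 1])
  ultimately have "((\<lambda>y::'a. (f (norm y) - f 0) / norm y) \<longlongrightarrow> 0) (at 0)"
    by (rule filterlim_compose)
  then have "((\<lambda>y::'a. norm (f (norm y) - f 0) / norm y) \<longlongrightarrow> 0) (at 0)"
    using tendsto_norm_zero by fastforce
  then show ?thesis using True
    by (simp add: has_derivative_iff_norm)
qed

section \<open>The Rodal profiles\<close>

lemma rodal_F_alt:
  assumes "\<sigma> > 0" "R > 0"
  shows "rodal_F \<sigma> R r = (cosh (\<sigma> * R))\<^sup>2 * inverse ((cosh (\<sigma> * r))\<^sup>2 + (sinh (\<sigma> * R))\<^sup>2)"
proof -
  define x y where "x = \<sigma> * r" and "y = \<sigma> * R"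
  have "sinh y > 0" using assms by (simp add: y_def)
  \<comment> \<open>Over a common denominator the difference of the \<open>tanh\<close> terms has
    the denominator rewritten in \<open>c\<close> and the numerator rewritten in
    \<open>s\<close>.\<close>
  have c: "cosh (x + y) * cosh (x - y) = (cosh x)\<^sup>2 + (sinh y)\<^sup>2"
    using hyperbolic_pythagoras[of x] hyperbolic_pythagoras[of y]
    by (simp add: cosh_add cosh_diff) algebra
  have s: "sinh (x + y) * cosh (x - y) - sinh (x - y) * cosh (x + y) = 2 * sinh y * cosh y"
  proof -
    have "sinh (x + y) * cosh (x - y) - cosh (x + y) * sinh (x - y) = sinh (y + y)"
      by (subst sinh_diff[symmetric]) (rule arg_cong[of _ _ sinh], simp)
    then show ?thesis by (simp only: sinh_add mult_ac)
  qed
  have nz: "cosh (x + y) \<noteq> 0" "cosh (x - y) \<noteq> 0" "cosh y \<noteq> 0" by simp_all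
  have "tanh (x + y) - tanh (x - y) = 2 * sinh y * cosh y / ((cosh x)\<^sup>2 + (sinh y)\<^sup>2)"
    unfolding c[symmetric] s[symmetric] tanh_def by (simp only: diff_frac_eq[OF nz(1,2)])
  moreover have "rodal_F \<sigma> R r = (tanh (x + y) - tanh (x - y)) / (2 * tanh y)"
    by (simp add: rodal_F_def x_def y_def algebra_simps)
  ultimately have "rodal_F \<sigma> R r = 2 * sinh y * cosh y / ((cosh x)\<^sup>2 + (sinh y)\<^sup>2) / (2 * (sinh y / cosh y))"
    by (simp add: tanh_def)
  also have "\<dots> = (cosh y)\<^sup>2 * inverse ((cosh x)\<^sup>2 + (sinh y)\<^sup>2)"
  proof -
    have "2 * S * C / A / (2 * (S / C)) = C\<^sup>2 * inverse A" if "S > 0" for S C A :: real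
      using that by (simp add: field_simps power2_eq_square)
    then show ?thesis using \<open>sinh y > 0\<close> by blast
  qed
  finally show ?thesis by (simp add: x_def y_def)
qed

text \<open>By its closed form \<open>F\<close> is a constant times the reciprocal of a positive
  polynomial in an even function, so the closure rules apply.\<close>

lemma even_smooth_rodal_F:
  assumes "\<sigma> > 0" "R > 0"
  shows "even_smooth n (rodal_F \<sigma> R)"
proof -
  have "(cosh (\<sigma> * r))\<^sup>2 + (sinh (\<sigma> * R))\<^sup>2 > 0" for r
    by (intro add_pos_nonneg) auto
  then have nz: "cosh (\<sigma> * r) * cosh (\<sigma> * r) + sinh (\<sigma> * R) * sinh (\<sigma> * R) \<noteq> 0" for r
    by (metis less_irrefl power2_eq_square)
  show ?thesis unfolding rodal_F_alt[OF assms, abs_def] power2_eq_square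
    by (intro even_smooth_mult even_smooth_const even_smooth_inverse even_smooth_add
        even_smooth_scale[OF even_smooth_cosh] nz)
qed

lemma rodal_G_deriv:
  assumes "\<sigma> > 0" "R > 0"
  shows "((\<lambda>s. s * rodal_G \<sigma> R s) has_real_derivative rodal_F \<sigma> R r) (at r)"
proof -
  have S: "sinh (R * \<sigma>) > 0" using assms by simp
  \<comment> \<open>At \<open>s = 0\<close> both sides vanish because \<open>cosh\<close> is even
    and the logarithms cancel; the identity holds on the whole line and can be differentiated at 0
    as well.\<close>
  have eq: "s * rodal_G \<sigma> R s = cosh (R * \<sigma>) / (2 * \<sigma> * sinh (R * \<sigma>)) *
      (ln (cosh (\<sigma> * (s + R))) - ln (cosh (\<sigma> * (s - R))))" for s
  proof (cases "s = 0")
    case True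
    have "cosh (- (\<sigma> * R)) = cosh (\<sigma> * R)" by (rule cosh_minus)
    then show ?thesis using True by simp
  next
    case False
    then show ?thesis using S assms by (simp add: rodal_G_def field_simps)
  qed
  show ?thesis unfolding eq
    by (rule derivative_eq_intros refl cosh_real_pos | simp)+
      (use S assms in \<open>simp add: rodal_F_def tanh_def field_simps\<close>)
qed

lemma even_smooth_rodal_G:
  assumes "\<sigma> > 0" "R > 0"
  shows "even_smooth n (rodal_G \<sigma> R)"
proof -
  have "rodal_G \<sigma> R r = integral {0..1} (\<lambda>s. s ^ 0 * rodal_F \<sigma> R (s * r))" for r
  proof (cases "r = 0")
    case True
    have "rodal_F \<sigma> R 0 = 1" using assms by (simp add: rodal_F_def)
    then show ?thesis using True by (simp add: rodal_G_def)
  next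
    case False
    have "r * integral {0..1} (\<lambda>s. rodal_F \<sigma> R (s * r)) = r * rodal_G \<sigma> R r"
      by (rule average_deriv[OF rodal_G_deriv[OF assms]]) simp
    then show ?thesis using False by simp
  qed
  then have "rodal_G \<sigma> R = (\<lambda>r. integral {0..1} (\<lambda>s. s ^ 0 * rodal_F \<sigma> R (s * r)))" by blast
  then show ?thesis using even_smooth_average[OF even_smooth_rodal_F[OF assms], of n 0] by simp
qed

section \<open>Curl-free shifts carried by a bubble\<close>

lemma time_part_add_scaleR: "time_part (p + h *\<^sub>R q) = time_part p + h * time_part q"
  by (simp add: time_part_def)

lemma space_part_add_scaleR: "space_part (p + h *\<^sub>R q) = space_part p + h *\<^sub>R space_part q"
  by (simp add: space_part_def vec_eq_iff forall_3)

lemma time_part_axis: "time_part (axis a 1) = (if a = 0 then 1 else 0)"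
  by (simp add: time_part_def axis_def)

lemma event_nth: "event t x $ 0 = t" "event t x $ 1 = x $ 1" "event t x $ 2 = x $ 2" "event t x $ 3 = x $ 3"
  by (simp_all add: event_def)

lemma space_part_axis: "space_part (axis 1 1) = axis 1 1" "space_part (axis 2 1) = axis 2 1"
    "space_part (axis 3 1) = axis 3 1"
  by (simp_all add: space_part_def vec_eq_iff forall_3 axis_def)

lemma has_partial_event:
  assumes "((\<lambda>h. u (p + h *\<^sub>R axis a 1)) has_vector_derivative D) (at 0)"
  shows "has_partial a (\<lambda>p. event 0 (u p) $ c) (event 0 D $ c) p"
proof -
  have "((\<lambda>h. u (p + h *\<^sub>R axis a 1) $ i) has_real_derivative D $ i) (at 0)" for i
    using bounded_linear.has_vector_derivative[OF bounded_linear_vec_nth assms, of i]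
    by (simp add: has_real_derivative_iff_has_vector_derivative)
  then show ?thesis unfolding has_partial_def
    by (induct c rule: index4_induct) (simp_all add: event_nth)
qed

lemma has_partial_has_derivative:
  fixes u :: "real^'n \<Rightarrow> real^'m"
  assumes "(u has_derivative (\<lambda>d. A *v d)) (at x)"
  shows "has_partial i (\<lambda>y. u y $ j) (A $ j $ i) x"
proof -
  have "((\<lambda>h. x + h *\<^sub>R axis i 1) has_derivative (\<lambda>h. h *\<^sub>R axis i 1)) (at (0::real))"
    by (auto intro!: derivative_eq_intros)
  moreover have "(u has_derivative (\<lambda>d. A *v d)) (at (x + 0 *\<^sub>R axis i 1))"
    using assms by simp
  ultimately have "((\<lambda>h. u (x + h *\<^sub>R axis i 1)) has_derivative (\<lambda>h. A *v (h *\<^sub>R axis i 1))) (at 0)"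
    by (rule has_derivative_compose)
  from bounded_linear.has_derivative[OF bounded_linear_vec_nth this, of j]
  show ?thesis unfolding has_partial_def has_field_derivative_def
    by (rule has_derivative_eq_rhs)
      (simp add: fun_eq_iff matrix_vector_mult_scaleR matrix_vector_mult_basis column_def)
qed

lemma curl_eq:
  assumes "(u has_derivative (\<lambda>d. A *v d)) (at x)"
  shows "curl u x = vector [A $ 3 $ 2 - A $ 2 $ 3, A $ 1 $ 3 - A $ 3 $ 1, A $ 2 $ 1 - A $ 1 $ 2]"
  by (simp add: curl_def has_partial_imp_partial[OF has_partial_has_derivative[OF assms]])

text \<open>The common shape of both drives: a field \<open>B\<close> with symmetric Jacobian \<open>J\<close>, carried along by the
  bubble centre \<open>c\<close>, on top of a linear Hubble flow.\<close>

locale transported_shift =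
  fixes \<beta> :: shift_field and k :: real and c c' :: "real \<Rightarrow> real^3"
    and B :: "real^3 \<Rightarrow> real^3" and J :: "real^3 \<Rightarrow> real^3^3"
  assumes shift: "\<beta> t x = k *\<^sub>R x + B (x - c t)"
    and centre: "(c has_vector_derivative c' t) (at t)"
    and B: "(B has_derivative (\<lambda>d. J y *v d)) (at y)"
    and J_sym: "J y $ i $ j = J y $ j $ i"
    and J: "(\<lambda>y. J y $ i $ j) differentiable (at y)"
begin

text \<open>The Hubble term adds a multiple of the identity to \<open>J\<close>, so the Jacobian
  stays symmetric.\<close>

lemma curl_free: "curl_free_at (\<beta> t) x"
proof -
  have "((\<lambda>x. B (x - c t)) has_derivative (\<lambda>d. J (x - c t) *v d)) (at x)"
    by (rule has_derivative_compose[OF _ B, of "\<lambda>x. x - c t" "\<lambda>d. d", simplified])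
      (auto intro!: derivative_eq_intros)
  then have D: "(\<beta> t has_derivative (\<lambda>d. (k *\<^sub>R mat 1 + J (x - c t)) *v d)) (at x)"
    unfolding shift[abs_def]
    by (auto intro!: derivative_eq_intros
        simp: matrix_vector_mult_add_rdistrib scaleR_matrix_vector_assoc[symmetric])
  have "curl (\<beta> t) x = 0"
    using J_sym[of "x - c t" 1 2] J_sym[of "x - c t" 1 3] J_sym[of "x - c t" 2 3]
    by (simp add: curl_eq[OF D] vec_eq_iff forall_3 mat_def)
  then show ?thesis using D by (auto simp: curl_free_at_def differentiable_def)
qed

definition offset :: "real^4 \<Rightarrow> real^3"
  where "offset p = space_part p - c (time_part p)"

text \<open>The derivative of \<open>offset\<close> in direction \<open>a\<close>: a unit vector for
  spatial \<open>a\<close>, minus the velocity of the centre for time.\<close>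

definition velocity :: "4 \<Rightarrow> real^4 \<Rightarrow> real^3"
  where "velocity a p = space_part (axis a 1) - time_part (axis a 1) *\<^sub>R c' (time_part p)"

definition shift_partial :: "4 \<Rightarrow> 4 \<Rightarrow> real^4 \<Rightarrow> real"
  where "shift_partial a b p =
    event 0 (k *\<^sub>R space_part (axis a 1) + J (offset p) *v velocity a p) $ b"

lemma has_vector_derivative_offset:
  "((\<lambda>h. offset (p + h *\<^sub>R axis a 1)) has_vector_derivative velocity a p) (at 0)"
proof -
  let ?s = "time_part (axis a 1)"
  have "((\<lambda>h. time_part p + h * ?s) has_vector_derivative ?s) (at 0)"
    by (auto intro!: derivative_eq_intros)
  from vector_diff_chain_at[OF this, of c "c' (time_part p)"] centre
  have "((\<lambda>h. c (time_part p + h * ?s)) has_vector_derivative ?s *\<^sub>R c' (time_part p)) (at 0)"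
    by (simp add: o_def)
  then show ?thesis unfolding offset_def time_part_add_scaleR space_part_add_scaleR velocity_def
    by (auto intro!: derivative_eq_intros)
qed

text \<open>For spatial \<open>b\<close> the velocity is a constant vector, so only \<open>J\<close>
  is differentiated along the path of the offset. For \<open>b = 0\<close> it contains
  \<open>c'\<close>, of which no derivative is assumed.\<close>

lemma has_partial_shift_partial:
  assumes "b \<noteq> 0"
  shows "has_partial a (shift_partial b d) (partial a (shift_partial b d) p) p"
proof -
  define q where "q h = offset (p + h *\<^sub>R axis a 1)" for h
  have q: "q differentiable (at 0)"
    using has_vector_derivative_offset[of p a] differentiableI_vector unfolding q_def by blast
  have J': "(\<lambda>h. J (q h) $ i $ j) differentiable (at 0)" for i j
    using differentiable_chain_at[OF q, of "\<lambda>y. J y $ i $ j"] J by (simp add: o_def)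
  have "(\<lambda>h. (J (q h) *v e) $ i) differentiable (at 0)" for e i
    unfolding matrix_vector_mult_def by (simp, intro differentiable_sum ballI)
      (simp_all add: J' differentiable_mult)
  then have "(\<lambda>h. shift_partial b d (p + h *\<^sub>R axis a 1)) differentiable (at 0)"
    using assms by (induct d rule: index4_induct)
      (simp_all add: shift_partial_def event_nth velocity_def time_part_axis q_def[symmetric])
  then show ?thesis
    by (simp add: has_partial_def partial_def DERIV_deriv_iff_real_differentiable)
qed

text \<open>The second derivatives are supplied as values of \<open>partial\<close> themselves, so
  only their existence is at stake.\<close>

sublocale curl_free_shift \<beta> shift_partial "\<lambda>a b d. partial a (shift_partial b d)"
proof
  fix a b d p
  have "((\<lambda>h. B (offset (p + h *\<^sub>R axis a 1))) has_vector_derivative J (offset p) *v velocity a p) (at 0)"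
    using vector_derivative_diff_chain_within[OF has_vector_derivative_offset[of p a], of B "\<lambda>d. J (offset p) *v d"]
      has_derivative_at_withinI[OF B[of "offset p"]]
    by (simp add: o_def)
  moreover have "((\<lambda>h. k *\<^sub>R space_part (p + h *\<^sub>R axis a 1)) has_vector_derivative
      k *\<^sub>R space_part (axis a 1)) (at 0)"
    unfolding space_part_add_scaleR by (auto intro!: derivative_eq_intros simp: algebra_simps)
  ultimately have "((\<lambda>h. \<beta> (time_part (p + h *\<^sub>R axis a 1)) (space_part (p + h *\<^sub>R axis a 1)))
      has_vector_derivative k *\<^sub>R space_part (axis a 1) + J (offset p) *v velocity a p) (at 0)"
    unfolding shift offset_def[symmetric] by (rule has_vector_derivative_add[rotated])
  from has_partial_event[where u = "\<lambda>p. \<beta> (time_part p) (space_part p)", OF this]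
  show "has_partial a (shift4 \<beta> d) (shift_partial a d p) p"
    by (simp add: shift4_def[abs_def] shift_partial_def)
next
  fix a b d :: 4 and p
  assume "b \<noteq> 0"
  then show "has_partial a (shift_partial b d) (partial a (shift_partial b d) p) p"
    by (rule has_partial_shift_partial)
next
  fix b d :: 4 and p
  have "\<forall>b d. b \<noteq> 0 \<longrightarrow> d \<noteq> 0 \<longrightarrow> shift_partial b d p = shift_partial d b p"
    unfolding all_index4
    by (simp add: shift_partial_def event_nth velocity_def time_part_axis space_part_axis
        matrix_vector_mult_basis column_def J_sym) (simp add: axis_def)
  then show "b \<noteq> 0 \<Longrightarrow> d \<noteq> 0 \<Longrightarrow> shift_partial b d p = shift_partial d b p" by blast
qed

end

section \<open>The two drives as transported shifts\<close>

lemma even_profile: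
  assumes "even_smooth (Suc n) f"
  obtains f' where "even_smooth n f'" "\<And>r. (f has_real_derivative r * f' r) (at r)"
    "\<And>y::real^3. ((\<lambda>y. f (norm y)) has_derivative (\<lambda>d. f' (norm y) * (y \<bullet> d))) (at y)"
  using assms has_derivative_even_norm by auto

text \<open>The Cartesian shift relative to the centre with \<open>y\<close> in place of the radial
  unit vector, so \<open>h\<close> stands for \<open>(F - G) / r\<^sup>2\<close>.\<close>

definition warp_field :: "real \<Rightarrow> (real \<Rightarrow> real) \<Rightarrow> (real \<Rightarrow> real) \<Rightarrow> real^3 \<Rightarrow> real^3"
  where "warp_field v g h y = - v *\<^sub>R (g (norm y) *\<^sub>R axis 1 1 + (h (norm y) * (y $ 1)) *\<^sub>R y)"

text \<open>\<open>a\<close> and \<open>b\<close> stand for the derivatives of \<open>g\<close> and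
  \<open>h\<close> divided by the radius. The matrix is symmetric when \<open>a = h\<close>.\<close>

definition warp_jacobian :: "real \<Rightarrow> real \<Rightarrow> real \<Rightarrow> real \<Rightarrow> real^3 \<Rightarrow> real^3^3"
  where "warp_jacobian v a h b y = (\<chi> i j. - v * (a * (y $ j * axis 1 1 $ i)
    + h * (axis 1 1 $ j * y $ i + y $ 1 * axis i 1 $ j) + b * y $ 1 * y $ i * y $ j))"

lemma has_derivative_vec_nth: "((\<lambda>y::real^'n. y $ i) has_derivative (\<lambda>d. d $ i)) (at y)"
  by (rule bounded_linear_imp_has_derivative[OF bounded_linear_vec_nth])

lemma has_derivative_warp_field:
  assumes "((\<lambda>y::real^3. g (norm y)) has_derivative (\<lambda>d. a * (y \<bullet> d))) (at y)"
    and "((\<lambda>y::real^3. h (norm y)) has_derivative (\<lambda>d. b * (y \<bullet> d))) (at y)"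
  shows "(warp_field v g h has_derivative (\<lambda>d. warp_jacobian v a (h (norm y)) b y *v d)) (at y)"
  unfolding warp_field_def[abs_def]
  by (rule has_derivative_eq_rhs, (rule derivative_intros assms has_derivative_vec_nth)+)
    (simp add: fun_eq_iff vec_eq_iff forall_3 warp_jacobian_def matrix_vector_mult_def sum_3
      inner_vec_def axis_def algebra_simps)

text \<open>The relation \<open>(r G)' = F\<close> says that \<open>(F - G) / r\<^sup>2\<close> and
  \<open>G' / r\<close> agree. Both are the even profile \<open>G1\<close>, which makes the Jacobian
  symmetric and removes the singularity at the centre.\<close>

lemma rodal_transported_shift:
  assumes "\<sigma> > 0" "R > 0"
  shows "\<exists>c c' B J. transported_shift (rodal_shift \<sigma> R v) 0 c c' B J"
proof -
  let ?G = "rodal_G \<sigma> R"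
  \<comment> \<open>The Jacobian contains \<open>G1\<close> and \<open>G2\<close> and must itself be
    differentiable, so three divided derivatives of \<open>G\<close> are taken.\<close>
  obtain G1 where G1: "even_smooth (Suc 1) G1" "\<And>r. (?G has_real_derivative r * G1 r) (at r)"
    "\<And>y::real^3. ((\<lambda>y. ?G (norm y)) has_derivative (\<lambda>d. G1 (norm y) * (y \<bullet> d))) (at y)"
    by (rule even_profile[OF even_smooth_rodal_G[OF assms]]) blast
  obtain G2 where G2: "even_smooth (Suc 0) G2"
    "\<And>y::real^3. ((\<lambda>y. G1 (norm y)) has_derivative (\<lambda>d. G2 (norm y) * (y \<bullet> d))) (at y)"
    by (rule even_profile[OF G1(1)]) (use One_nat_def in metis)
  obtain G3 where G3:
    "\<And>y::real^3. ((\<lambda>y. G2 (norm y)) has_derivative (\<lambda>d. G3 (norm y) * (y \<bullet> d))) (at y)"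
    by (rule even_profile[OF G2(1)]) blast
  have FG: "rodal_F \<sigma> R r - ?G r = r * r * G1 r" for r
    using DERIV_unique[OF rodal_G_deriv[OF assms, of r] DERIV_mult[OF DERIV_ident G1(2)[of r]]]
    by simp
  let ?B = "warp_field v ?G G1"
  let ?J = "\<lambda>y. warp_jacobian v (G1 (norm y)) (G1 (norm y)) (G2 (norm y)) y"
  have "transported_shift (rodal_shift \<sigma> R v) 0 (bubble_centre v) (\<lambda>t. vector [v, 0, 0]) ?B ?J"
  proof
    fix t x
    define y where "y = x - bubble_centre v t"
    have "((rodal_F \<sigma> R (norm y) - ?G (norm y)) * (y /\<^sub>R norm y) $ 1) *\<^sub>R (y /\<^sub>R norm y)
        = (G1 (norm y) * (y $ 1)) *\<^sub>R y"
      by (cases "y = 0") (simp_all add: FG field_simps)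
    then show "rodal_shift \<sigma> R v t x = 0 *\<^sub>R x + ?B (x - bubble_centre v t)"
      by (simp add: rodal_shift_def Let_def warp_field_def y_def)
  next
    fix t
    have "bubble_centre v = (\<lambda>t. t *\<^sub>R vector [v, 0, 0])"
      by (simp add: fun_eq_iff bubble_centre_def vec_eq_iff forall_3)
    then show "(bubble_centre v has_vector_derivative vector [v, 0, 0]) (at t)"
      by (auto intro!: derivative_eq_intros)
  next
    fix y
    show "(?B has_derivative (\<lambda>d. ?J y *v d)) (at y)"
      by (rule has_derivative_warp_field[OF G1(3) G2(2)])
  next
    fix y i j
    show "?J y $ i $ j = ?J y $ j $ i"
      by (simp add: warp_jacobian_def axis_def algebra_simps)
    have "(\<lambda>y::real^3. G1 (norm y)) differentiable (at y)" "(\<lambda>y::real^3. G2 (norm y)) differentiable (at y)"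
      "(\<lambda>y::real^3. y $ i) differentiable (at y)" for i
      using G2(2) G3 has_derivative_vec_nth unfolding differentiable_def by blast+
    then show "(\<lambda>y. ?J y $ i $ j) differentiable (at y)"
      unfolding warp_jacobian_def by simp
  qed
  then show ?thesis by blast
qed

text \<open>Matching turns the shift into a linear flow plus \<open>H * f\<close> times the offset
  from the centre. The latter is a radial field, so its Jacobian is symmetric.\<close>

lemma gz_transported_shift:
  assumes "\<sigma> > 0" "R > 0" "H > 0" "gz_matching H r0 xs vs"
  shows "\<exists>k c c' B J. transported_shift (gz_shift \<sigma> R H xs vs) k c c' B J"
proof -
  let ?F = "rodal_F \<sigma> R"
  obtain F1 where F1: "even_smooth (Suc 0) F1"
    "\<And>y::real^3. ((\<lambda>y. ?F (norm y)) has_derivative (\<lambda>d. F1 (norm y) * (y \<bullet> d))) (at y)"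
    by (rule even_profile[OF even_smooth_rodal_F[OF assms(1,2)]]) blast
  obtain F2 where F2:
    "\<And>y::real^3. ((\<lambda>y. F1 (norm y)) has_derivative (\<lambda>d. F2 (norm y) * (y \<bullet> d))) (at y)"
    by (rule even_profile[OF F1(1)]) blast
  define B :: "real^3 \<Rightarrow> real^3" where "B y = (H * ?F (norm y)) *\<^sub>R y" for y
  define J :: "real^3 \<Rightarrow> real^3^3"
    where "J y = (\<chi> i j. H * (F1 (norm y) * y $ i * y $ j + ?F (norm y) * axis i 1 $ j))" for y
  have "transported_shift (gz_shift \<sigma> R H xs vs) (- H) xs vs B J"
  proof
    fix t x
    have "vs t = H *\<^sub>R xs t" using assms(4) by (simp add: gz_matching_def)
    then show "gz_shift \<sigma> R H xs vs t x = - H *\<^sub>R x + B (x - xs t)"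
      using \<open>H > 0\<close> by (simp add: gz_shift_def Let_def B_def algebra_simps)
  next
    fix t show "(xs has_vector_derivative vs t) (at t)"
      using assms(4) unfolding gz_matching_def by blast
  next
    fix y
    show "(B has_derivative (\<lambda>d. J y *v d)) (at y)"
      unfolding B_def[abs_def]
      by (rule has_derivative_eq_rhs, (rule derivative_intros F1(2) has_derivative_vec_nth)+)
        (simp add: fun_eq_iff vec_eq_iff forall_3 J_def matrix_vector_mult_def sum_3 inner_vec_def
          axis_def algebra_simps)
  next
    fix y i j
    show "J y $ i $ j = J y $ j $ i"
      by (simp add: J_def axis_def algebra_simps)
    have "(\<lambda>y::real^3. ?F (norm y)) differentiable (at y)" "(\<lambda>y::real^3. F1 (norm y)) differentiable (at y)"
      "(\<lambda>y::real^3. y $ i) differentiable (at y)" for i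
      using F1(2) F2 has_derivative_vec_nth unfolding differentiable_def by blast+
    then show "(\<lambda>y. J y $ i $ j) differentiable (at y)"
      unfolding J_def by simp
  qed
  then show ?thesis by blast
qed

section \<open>Curl of a general warp shift\<close>

lemma spherical_frame_orthonormal:
  "e_r \<theta> \<phi> \<bullet> e_r \<theta> \<phi> = 1" "e_theta \<theta> \<phi> \<bullet> e_theta \<theta> \<phi> = 1" "e_phi \<theta> \<phi> \<bullet> e_phi \<theta> \<phi> = 1"
  "e_r \<theta> \<phi> \<bullet> e_theta \<theta> \<phi> = 0" "e_r \<theta> \<phi> \<bullet> e_phi \<theta> \<phi> = 0" "e_theta \<theta> \<phi> \<bullet> e_phi \<theta> \<phi> = 0"
  "axis 1 1 \<bullet> e_r \<theta> \<phi> = cos \<theta>" "axis 1 1 \<bullet> e_theta \<theta> \<phi> = - sin \<theta>" "axis 1 1 \<bullet> e_phi \<theta> \<phi> = 0"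
  by (simp_all add: e_r_def e_theta_def e_phi_def inner_vec_def sum_3 axis_def)
    (use sin_cos_squared_add[of \<theta>] sin_cos_squared_add[of \<phi>] in algebra)+

lemma spherical_frame_expansion:
  "w = (w \<bullet> e_r \<theta> \<phi>) *\<^sub>R e_r \<theta> \<phi> + (w \<bullet> e_theta \<theta> \<phi>) *\<^sub>R e_theta \<theta> \<phi> + (w \<bullet> e_phi \<theta> \<phi>) *\<^sub>R e_phi \<theta> \<phi>"
  by (simp add: vec_eq_iff forall_3 e_r_def e_theta_def e_phi_def inner_vec_def sum_3, intro conjI)
    (use sin_cos_squared_add[of \<theta>] sin_cos_squared_add[of \<phi>] in algebra)+

lemma spherical_frame_eqI:
  assumes "b \<bullet> e_r \<theta> \<phi> = w \<bullet> e_r \<theta> \<phi>" "b \<bullet> e_theta \<theta> \<phi> = w \<bullet> e_theta \<theta> \<phi>"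
    "b \<bullet> e_phi \<theta> \<phi> = w \<bullet> e_phi \<theta> \<phi>"
  shows "b = w"
proof -
  have "b - w = 0"
    by (subst spherical_frame_expansion[of _ \<theta> \<phi>]) (simp add: inner_diff_left assms)
  then show ?thesis by simp
qed

lemma norm_e_r: "norm (e_r \<theta> \<phi>) = 1"
  by (simp add: norm_eq_sqrt_inner spherical_frame_orthonormal)

lemma e_r_nth: "e_r \<theta> \<phi> $ 1 = cos \<theta>" "e_r \<theta> \<phi> $ 2 = sin \<theta> * cos \<phi>" "e_r \<theta> \<phi> $ 3 = sin \<theta> * sin \<phi>"
  by (simp_all add: e_r_def)

lemma spherical_coordinates:
  fixes y :: "real^3"
  assumes "y \<noteq> 0"
  obtains \<theta> \<phi> where "0 \<le> \<theta>" "\<theta> \<le> pi" "y = norm y *\<^sub>R e_r \<theta> \<phi>"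
proof -
  define r where "r = norm y"
  define \<rho> where "\<rho> = sqrt ((y $ 2)\<^sup>2 + (y $ 3)\<^sup>2)"
  have r: "r\<^sup>2 = (y $ 1)\<^sup>2 + (y $ 2)\<^sup>2 + (y $ 3)\<^sup>2"
    by (simp only: r_def power2_norm_eq_inner)
      (simp add: inner_vec_def sum_3 power2_eq_square)
  have "r > 0" using assms by (simp add: r_def)
  note r = this r
  have \<rho>: "\<rho> \<ge> 0" "\<rho>\<^sup>2 = (y $ 2)\<^sup>2 + (y $ 3)\<^sup>2" by (simp_all add: \<rho>_def)
  have "(y $ 1 / r)\<^sup>2 + (\<rho> / r)\<^sup>2 = 1"
    using r(1) by (simp add: power_divide add_divide_distrib[symmetric] \<rho>(2) r(2)[symmetric]
        add.assoc[symmetric])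
  then obtain \<theta> where \<theta>: "0 \<le> \<theta>" "\<theta> \<le> pi" "y $ 1 / r = cos \<theta>" "\<rho> / r = sin \<theta>"
    using sincos_total_pi[of "\<rho> / r" "y $ 1 / r"] r \<rho> by auto
  obtain \<phi> where \<phi>: "y $ 2 = \<rho> * cos \<phi>" "y $ 3 = \<rho> * sin \<phi>"
  proof (cases "\<rho> = 0")
    case True
    then show ?thesis using that \<rho>(2) by (simp add: sum_power2_eq_zero_iff)
  next
    case False
    then have "(y $ 2 / \<rho>)\<^sup>2 + (y $ 3 / \<rho>)\<^sup>2 = 1"
      by (simp add: power_divide add_divide_distrib[symmetric] \<rho>(2)[symmetric])
    then obtain t where "y $ 2 / \<rho> = cos t" "y $ 3 / \<rho> = sin t"
      using sincos_total_2pi[of "y $ 2 / \<rho>" "y $ 3 / \<rho>"] by auto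
    then show ?thesis using that[of t] False by (simp add: field_simps)
  qed
  have "y = r *\<^sub>R e_r \<theta> \<phi>"
    using \<theta>(3,4)[symmetric] \<phi> r(1) by (simp add: vec_eq_iff forall_3 e_r_nth)
  then show ?thesis using that \<theta> by (simp add: r_def)
qed

lemma warp_field_spherical:
  assumes "r > 0"
  shows "warp_field v G (\<lambda>r. (F r - G r) / (r * r)) (r *\<^sub>R e_r \<theta> \<phi>) =
    - v *\<^sub>R (G r *\<^sub>R axis 1 1 + ((F r - G r) * cos \<theta>) *\<^sub>R e_r \<theta> \<phi>)"
  using assms by (simp add: warp_field_def norm_e_r e_r_nth)

text \<open>Frame components determine a vector, and spherical coordinates reach every point but the
  centre. The Cartesian form is not singular on the polar axis and can be differentiated
  there.\<close>

lemma has_warp_components_iff: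
  "has_warp_components v F G \<beta> \<longleftrightarrow>
    (\<forall>t y. y \<noteq> 0 \<longrightarrow> \<beta> t (bubble_centre v t + y) = warp_field v G (\<lambda>r. (F r - G r) / (r * r)) y)"
  (is "_ \<longleftrightarrow> (\<forall>t y. y \<noteq> 0 \<longrightarrow> _ = ?w y)")
proof -
  have *: "(b \<bullet> e_r \<theta> \<phi> = - v * F r * cos \<theta> \<and> b \<bullet> e_theta \<theta> \<phi> = v * G r * sin \<theta> \<and> b \<bullet> e_phi \<theta> \<phi> = 0)
      \<longleftrightarrow> b = ?w (r *\<^sub>R e_r \<theta> \<phi>)" if "r > 0" for b \<theta> \<phi> r
  proof -
    have w: "?w (r *\<^sub>R e_r \<theta> \<phi>) \<bullet> e_r \<theta> \<phi> = - v * F r * cos \<theta>"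
      "?w (r *\<^sub>R e_r \<theta> \<phi>) \<bullet> e_theta \<theta> \<phi> = v * G r * sin \<theta>"
      "?w (r *\<^sub>R e_r \<theta> \<phi>) \<bullet> e_phi \<theta> \<phi> = 0"
      unfolding warp_field_spherical[OF that]
      by (simp_all add: inner_add_left spherical_frame_orthonormal algebra_simps)
    show ?thesis
    proof
      assume "b \<bullet> e_r \<theta> \<phi> = - v * F r * cos \<theta> \<and> b \<bullet> e_theta \<theta> \<phi> = v * G r * sin \<theta> \<and>
        b \<bullet> e_phi \<theta> \<phi> = 0"
      then show "b = ?w (r *\<^sub>R e_r \<theta> \<phi>)"
        using w by (intro spherical_frame_eqI[of _ \<theta> \<phi>]) simp_all
    qed (use w in simp)
  qed
  show ?thesis
  proof
    assume L: "has_warp_components v F G \<beta>"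
    show "\<forall>t y. y \<noteq> 0 \<longrightarrow> \<beta> t (bubble_centre v t + y) = ?w y"
    proof (intro allI impI)
      fix t and y :: "real^3" assume y: "y \<noteq> 0"
      obtain \<theta> \<phi> where s: "0 \<le> \<theta>" "\<theta> \<le> pi" "y = norm y *\<^sub>R e_r \<theta> \<phi>"
        using spherical_coordinates[OF y] .
      have "norm y > 0" using y by simp
      from L[unfolded has_warp_components_def Let_def, rule_format, of "norm y" \<theta> t \<phi>] this s(1,2)
      have "\<beta> t (bubble_centre v t + norm y *\<^sub>R e_r \<theta> \<phi>) = ?w (norm y *\<^sub>R e_r \<theta> \<phi>)"
        using *[OF \<open>norm y > 0\<close>] by blast
      then show "\<beta> t (bubble_centre v t + y) = ?w y" using s(3) by simp
    qed
  next
    assume R: "\<forall>t y. y \<noteq> 0 \<longrightarrow> \<beta> t (bubble_centre v t + y) = ?w y"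
    have "r *\<^sub>R e_r \<theta> \<phi> \<noteq> 0" if "r > 0" for r \<theta> \<phi>
      using norm_e_r[of \<theta> \<phi>] that by auto
    then show "has_warp_components v F G \<beta>"
      unfolding has_warp_components_def Let_def using * R by blast
  qed
qed

lemma rodal_has_warp_components:
  "has_warp_components v (rodal_F \<sigma> R) (rodal_G \<sigma> R) (rodal_shift \<sigma> R v)"
proof -
  have "d * (inverse r * a) * inverse r = d * a / (r * r)" for d r a :: real
    by (simp add: divide_inverse)
  then show ?thesis
    unfolding has_warp_components_iff rodal_shift_def Let_def warp_field_def by simp
qed

section \<open>Curl away from the centre and at it\<close>

lemma deriv_even_zero:
  fixes f :: "real \<Rightarrow> real"
  assumes "(f has_real_derivative D) (at 0)" and "\<And>h. f (- h) = f h"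
  shows "D = 0"
proof -
  have "((\<lambda>h. f (- h)) has_real_derivative - D) (at 0)"
    using DERIV_compose_cmult[of f D "- 1" 0] assms(1) by simp
  then have "(f has_real_derivative - D) (at 0)" by (simp only: assms(2))
  from DERIV_unique[OF this assms(1)] show ?thesis by simp
qed

text \<open>The antisymmetric part of \<open>warp_jacobian\<close> comes from the difference of
  \<open>G' / r\<close> and \<open>(F - G) / r\<^sup>2\<close>, which is
  \<open>((r G)' - F) / r\<^sup>2\<close>. The vector on the right is
  \<open>r * sin \<theta>\<close> times \<open>e_phi\<close>.\<close>

lemma curl_warp_shift:
  assumes diff: "F differentiable (at r)" "G differentiable (at r)"
    and warp: "has_warp_components v F G \<beta>" and r: "r = norm y" "y \<noteq> 0"
  shows "\<beta> t differentiable (at (bubble_centre v t + y))"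
    and "curl (\<beta> t) (bubble_centre v t + y) =
      (v / r\<^sup>2 * (deriv (\<lambda>s. s * G s) r - F r)) *\<^sub>R vector [0, - y $ 3, y $ 2]"
proof -
  let ?h = "\<lambda>r. (F r - G r) / (r * r)" and ?c = "bubble_centre v t"
  have "r > 0" using r by simp
  have G': "(G has_real_derivative deriv G r) (at r)"
    using diff(2) by (simp add: DERIV_deriv_iff_real_differentiable)
  have "?h differentiable (at r)"
    using diff \<open>r > 0\<close> by (intro differentiable_divide differentiable_diff differentiable_mult) simp_all
  then have h': "(?h has_real_derivative deriv ?h r) (at r)"
    by (simp add: DERIV_deriv_iff_real_differentiable)
  define A where "A = warp_jacobian v (deriv G r / r) (?h r) (deriv ?h r / r) y"
  have "(warp_field v G ?h has_derivative (\<lambda>d. A *v d)) (at y)"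
    unfolding A_def using has_derivative_warp_field[OF has_derivative_radial[OF G'[unfolded r(1)] r(2)]
      has_derivative_radial[OF h'[unfolded r(1)] r(2)]] unfolding r(1) .
  then have "(warp_field v G ?h has_derivative (\<lambda>d. A *v d)) (at (?c + y - ?c))"
    by simp
  moreover have "((\<lambda>x. x - ?c) has_derivative (\<lambda>d. d)) (at (?c + y))"
    by (auto intro!: derivative_eq_intros)
  ultimately have "((\<lambda>x. warp_field v G ?h (x - ?c)) has_derivative (\<lambda>d. A *v d)) (at (?c + y))"
    by (rule has_derivative_compose[rotated])
  \<comment> \<open>The components prescribe \<open>\<beta> t\<close> only off the centre, so the
    derivative is transferred on the punctured space.\<close>
  then have D: "(\<beta> t has_derivative (\<lambda>d. A *v d)) (at (?c + y))"
  proof (rule has_derivative_transform_within_open[where s = "- {?c}"])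
    fix x assume "x \<in> - {?c}"
    then show "warp_field v G ?h (x - ?c) = \<beta> t x"
      using warp[unfolded has_warp_components_iff, rule_format, of "x - ?c" t] by simp
  qed (use r in auto)
  then show "\<beta> t differentiable (at (?c + y))" by (auto simp: differentiable_def)
  have "deriv (\<lambda>s. s * G s) r = G r + r * deriv G r"
    using DERIV_mult[OF DERIV_ident G'] by (intro DERIV_imp_deriv) (simp add: mult.commute)
  then have coeff: "deriv G r / r - ?h r = (deriv (\<lambda>s. s * G s) r - F r) / r\<^sup>2"
    using \<open>r > 0\<close> by (simp add: field_simps power2_eq_square)
  have "curl (\<beta> t) (?c + y) = (v * (deriv G r / r - ?h r)) *\<^sub>R vector [0, - y $ 3, y $ 2]"
    unfolding curl_eq[OF D] A_def
    by (simp add: vec_eq_iff forall_3 warp_jacobian_def axis_def) (simp add: algebra_simps)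
  then show "curl (\<beta> t) (?c + y) =
      (v / r\<^sup>2 * (deriv (\<lambda>s. s * G s) r - F r)) *\<^sub>R vector [0, - y $ 3, y $ 2]"
    unfolding coeff by simp
qed

text \<open>At the bubble centre every off-diagonal entry of the Jacobian is the derivative of an even
  function, whatever the profiles are.\<close>

lemma curl_warp_shift_centre:
  assumes warp: "has_warp_components v F G \<beta>" and diff: "\<beta> t differentiable (at (bubble_centre v t))"
  shows "curl (\<beta> t) (bubble_centre v t) = 0"
proof -
  let ?c = "bubble_centre v t"
  obtain D where D: "(\<beta> t has_derivative D) (at ?c)" using diff by (auto simp: differentiable_def)
  then have "D = (\<lambda>d. matrix D *v d)"
    by (rule matrix_vector_mul(2)[OF has_derivative_linear, symmetric])
  with D have D': "(\<beta> t has_derivative (\<lambda>d. matrix D *v d)) (at ?c)" by simp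
  have off: "matrix D $ j $ i = 0" if "i \<noteq> j" for i j
  proof (rule deriv_even_zero)
    show "((\<lambda>h. \<beta> t (?c + h *\<^sub>R axis i 1) $ j) has_real_derivative matrix D $ j $ i) (at 0)"
      using has_partial_has_derivative[OF D', of i j] by (simp add: has_partial_def)
    \<comment> \<open>On the \<open>i\<close>-th axis the product \<open>y $ 1 * y $ j\<close>
      vanishes for \<open>j \<noteq> i\<close>, which leaves a function of
      \<open>\<bar>h\<bar>\<close>.\<close>
    have axis: "\<beta> t (?c + h *\<^sub>R axis i 1) $ j = - v * (G \<bar>h\<bar> * axis 1 1 $ j)" if "h \<noteq> 0" for h
    proof -
      have "h *\<^sub>R axis i 1 \<noteq> (0 :: real^3)" using that by (simp add: axis_eq_0_iff)
      with warp[unfolded has_warp_components_iff, rule_format, OF this, of t] \<open>i \<noteq> j\<close>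
      show ?thesis by (simp add: warp_field_def) (simp add: axis_def)
    qed
    show "\<beta> t (?c + (- h) *\<^sub>R axis i 1) $ j = \<beta> t (?c + h *\<^sub>R axis i 1) $ j" for h
      using axis[of h] axis[of "- h"] by (cases "h = 0") simp_all
  qed
  show ?thesis unfolding curl_eq[OF D'] by (simp add: off vec_eq_iff forall_3)
qed

lemma curl_warp_shift_spherical:
  assumes diff: "F differentiable (at r)" "G differentiable (at r)"
    and warp: "has_warp_components v F G \<beta>" and r: "r > 0"
  shows "curl (\<beta> t) (bubble_centre v t + r *\<^sub>R e_r \<theta> \<phi>) =
    (v * sin \<theta> / r * (deriv (\<lambda>s. s * G s) r - F r)) *\<^sub>R e_phi \<theta> \<phi>"
proof -
  have "r = norm (r *\<^sub>R e_r \<theta> \<phi>)" "r *\<^sub>R e_r \<theta> \<phi> \<noteq> 0"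
    using r norm_e_r[of \<theta> \<phi>] by auto
  from curl_warp_shift(2)[OF diff warp this]
  have "curl (\<beta> t) (bubble_centre v t + r *\<^sub>R e_r \<theta> \<phi>) =
      (v / r\<^sup>2 * (deriv (\<lambda>s. s * G s) r - F r)) *\<^sub>R ((r * sin \<theta>) *\<^sub>R e_phi \<theta> \<phi>)"
    by (simp add: vec_eq_iff forall_3 e_r_nth e_phi_def)
  also have "\<dots> = (v * sin \<theta> / r * (deriv (\<lambda>s. s * G s) r - F r)) *\<^sub>R e_phi \<theta> \<phi>"
    using r by (simp add: power2_eq_square)
  finally show ?thesis .
qed

lemma curl_free_warp_shift_iff:
  assumes diff: "\<forall>r>0. F differentiable (at r) \<and> G differentiable (at r)"
    and warp: "has_warp_components v F G \<beta>" and v: "v \<noteq> 0"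
  shows "(\<forall>x. x \<noteq> bubble_centre v t \<longrightarrow> curl_free_at (\<beta> t) x) \<longleftrightarrow>
    (\<forall>r>0. F r = deriv (\<lambda>s. s * G s) r)" (is "?L \<longleftrightarrow> ?R")
proof
  assume L: ?L
  show ?R
  proof (intro allI impI)
    fix r :: real assume r: "r > 0"
    have d: "F differentiable (at r)" "G differentiable (at r)" using diff r by auto
    \<comment> \<open>On the equator \<open>sin \<theta> = 1\<close>, so the curl there recovers the
      relation at radius \<open>r\<close>.\<close>
    have "r *\<^sub>R e_r (pi / 2) 0 \<noteq> 0" using r norm_e_r[of "pi / 2" 0] by auto
    then have "curl (\<beta> t) (bubble_centre v t + r *\<^sub>R e_r (pi / 2) 0) = 0"
      using L by (simp add: curl_free_at_def)
    then have "v * sin (pi / 2) / r * (deriv (\<lambda>s. s * G s) r - F r) = 0"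
      unfolding curl_warp_shift_spherical[OF d warp r]
      using spherical_frame_orthonormal(3)[of "pi / 2" 0] by auto
    then show "F r = deriv (\<lambda>s. s * G s) r" using v r by simp
  qed
next
  assume R: ?R
  show ?L
  proof (intro allI impI)
    fix x assume "x \<noteq> bubble_centre v t"
    then have y: "x - bubble_centre v t \<noteq> 0" by simp
    then have n: "norm (x - bubble_centre v t) > 0" by simp
    have d: "F differentiable (at (norm (x - bubble_centre v t)))"
      "G differentiable (at (norm (x - bubble_centre v t)))"
      using diff n by auto
    show "curl_free_at (\<beta> t) x"
      using curl_warp_shift[OF d warp refl y, of t] R n by (simp add: curl_free_at_def)
  qed
qed


theorem lemma3:
  fixes R \<sigma> v :: real
  assumes "R > 0" and "\<sigma> > 0"
  shows
    "(\<forall>(F :: real \<Rightarrow> real) (G :: real \<Rightarrow> real) (\<beta> :: shift_field) t.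
        (\<forall>r>0. F differentiable (at r) \<and> G differentiable (at r)) \<and>
        has_warp_components v F G \<beta> \<longrightarrow>
          (\<forall>r \<theta> \<phi>. r > 0 \<and> 0 \<le> \<theta> \<and> \<theta> \<le> pi \<longrightarrow>
             (let c = curl (\<beta> t) (bubble_centre v t + r *\<^sub>R e_r \<theta> \<phi>) in
                c \<bullet> e_r \<theta> \<phi> = 0 \<and>
                c \<bullet> e_theta \<theta> \<phi> = 0 \<and>
                c \<bullet> e_phi \<theta> \<phi> = v * sin \<theta> / r * (deriv (\<lambda>s. s * G s) r - F r))) \<and>
          (v \<noteq> 0 \<longrightarrow>
             ((\<forall>x. x \<noteq> bubble_centre v t \<longrightarrow> curl_free_at (\<beta> t) x)
                \<longleftrightarrow> (\<forall>r>0. F r = deriv (\<lambda>s. s * G s) r))) \<and>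
          (v \<noteq> 0 \<and> \<beta> t differentiable (at (bubble_centre v t)) \<longrightarrow>
             ((\<forall>x. curl_free_at (\<beta> t) x)
                \<longleftrightarrow> (\<forall>r>0. F r = deriv (\<lambda>s. s * G s) r)))) \<and>
     (\<forall>r. ((\<lambda>s. s * rodal_G \<sigma> R s) has_real_derivative rodal_F \<sigma> R r) (at r)) \<and>
     has_warp_components v (rodal_F \<sigma> R) (rodal_G \<sigma> R) (rodal_shift \<sigma> R v) \<and>
     (\<forall>t x. let \<beta> = rodal_shift \<sigma> R v; p = event t x;
                g = shift_metric \<beta> p; T = mixed_stress_energy (shift_metric \<beta>) p
            in curl_free_at (\<beta> t) x \<and>
               momentum_density \<beta> p = 0 \<and>
               eulerian_block_diagonal \<beta> p \<and>
               real_spectrum T \<and>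
               timelike_eigenvector g T (slice_normal \<beta> p) \<and>
               hawking_ellis_type_I g T) \<and>
     (\<forall>H r0 xs vs. H > 0 \<and> gz_matching H r0 xs vs \<longrightarrow>
        (\<forall>t x. let \<beta> = gz_shift \<sigma> R H xs vs; p = event t x;
                   g = shift_metric \<beta> p; T = mixed_stress_energy (shift_metric \<beta>) p
               in curl_free_at (\<beta> t) x \<and>
                  momentum_density \<beta> p = 0 \<and>
                  eulerian_block_diagonal \<beta> p \<and>
                  real_spectrum T \<and>
                  timelike_eigenvector g T (slice_normal \<beta> p) \<and>
                  hawking_ellis_type_I g T))"
proof (intro conjI allI impI, elim conjE)
  fix F G :: "real \<Rightarrow> real" and \<beta> :: shift_field and t r \<theta> \<phi> :: real
  assume *: "\<forall>r>0. F differentiable (at r) \<and> G differentiable (at r)"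
      "has_warp_components v F G \<beta>" "0 < r"
  then have "F differentiable (at r)" "G differentiable (at r)" by auto
  from curl_warp_shift_spherical[OF this *(2,3)]
  show "let c = curl (\<beta> t) (bubble_centre v t + r *\<^sub>R e_r \<theta> \<phi>) in
      c \<bullet> e_r \<theta> \<phi> = 0 \<and> c \<bullet> e_theta \<theta> \<phi> = 0 \<and>
      c \<bullet> e_phi \<theta> \<phi> = v * sin \<theta> / r * (deriv (\<lambda>s. s * G s) r - F r)"
    using spherical_frame_orthonormal[of \<theta> \<phi>] by (simp add: Let_def inner_commute)
next
  fix F G :: "real \<Rightarrow> real" and \<beta> :: shift_field and t :: real
  assume "(\<forall>r>0. F differentiable (at r) \<and> G differentiable (at r)) \<and> has_warp_components v F G \<beta>"
    and "v \<noteq> 0"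
  then show "(\<forall>x. x \<noteq> bubble_centre v t \<longrightarrow> curl_free_at (\<beta> t) x) \<longleftrightarrow>
      (\<forall>r>0. F r = deriv (\<lambda>s. s * G s) r)"
    using curl_free_warp_shift_iff by blast
next
  fix F G :: "real \<Rightarrow> real" and \<beta> :: shift_field and t :: real
  assume *: "(\<forall>r>0. F differentiable (at r) \<and> G differentiable (at r)) \<and> has_warp_components v F G \<beta>"
    and **: "v \<noteq> 0 \<and> \<beta> t differentiable (at (bubble_centre v t))"
  \<comment> \<open>Given differentiability at the centre, the curl vanishes there for all profiles,
    so the condition on all points reduces to the one off the centre.\<close>
  have "curl_free_at (\<beta> t) (bubble_centre v t)"
    using curl_warp_shift_centre[of v F G \<beta> t] * ** by (simp add: curl_free_at_def)
  then show "(\<forall>x. curl_free_at (\<beta> t) x) \<longleftrightarrow> (\<forall>r>0. F r = deriv (\<lambda>s. s * G s) r)"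
    using curl_free_warp_shift_iff[of F G v \<beta> t] * ** by metis
next
  fix r
  show "((\<lambda>s. s * rodal_G \<sigma> R s) has_real_derivative rodal_F \<sigma> R r) (at r)"
    by (rule rodal_G_deriv[OF assms(2,1)])
next
  show "has_warp_components v (rodal_F \<sigma> R) (rodal_G \<sigma> R) (rodal_shift \<sigma> R v)"
    by (rule rodal_has_warp_components)
next
  fix t x
  obtain c c' B J where "transported_shift (rodal_shift \<sigma> R v) 0 c c' B J"
    using rodal_transported_shift[OF assms(2,1)] by blast
  \<comment> \<open>The sublocale makes the curvature results of \<open>curl_free_shift\<close>
    available for this drive.\<close>
  then interpret transported_shift "rodal_shift \<sigma> R v" 0 c c' B J .
  show "let \<beta> = rodal_shift \<sigma> R v; p = event t x;
            g = shift_metric \<beta> p; T = mixed_stress_energy (shift_metric \<beta>) p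
        in curl_free_at (\<beta> t) x \<and> momentum_density \<beta> p = 0 \<and> eulerian_block_diagonal \<beta> p \<and>
          real_spectrum T \<and> timelike_eigenvector g T (slice_normal \<beta> p) \<and> hawking_ellis_type_I g T"
    by (simp only: Let_def curl_free momentum_density_zero block_diagonal real_spectrum
        timelike_normal type_I simp_thms)
next
  fix H r0 xs vs t x
  assume "0 < H \<and> gz_matching H r0 xs vs"
  then obtain k c c' B J where "transported_shift (gz_shift \<sigma> R H xs vs) k c c' B J"
    using gz_transported_shift[OF assms(2,1)] by blast
  then interpret transported_shift "gz_shift \<sigma> R H xs vs" k c c' B J .
  show "let \<beta> = gz_shift \<sigma> R H xs vs; p = event t x;
            g = shift_metric \<beta> p; T = mixed_stress_energy (shift_metric \<beta>) p
        in curl_free_at (\<beta> t) x \<and> momentum_density \<beta> p = 0 \<and> eulerian_block_diagonal \<beta> p \<and>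
          real_spectrum T \<and> timelike_eigenvector g T (slice_normal \<beta> p) \<and> hawking_ellis_type_I g T"
    by (simp only: Let_def curl_free momentum_density_zero block_diagonal real_spectrum
        timelike_normal type_I simp_thms)
qed

end
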